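(* Consider a $\nu$-stage penalized IMEX Runge-Kutta scheme with coefficients $(\tilde A,\tilde w,A,w)$ for the Boltzmann equation $\partial_t f+v\cdot\nabla_x f=\frac1\varepsilon Q_B(f)=\frac1\varepsilon G_P(f)+\frac1\varepsilon Q_P(f)$, i.e. for $n\ge0$ $$F=f^n e+\Delta t\,\tilde A\left(\frac1\varepsilon G_P(F)+L(F)\right)+\frac{\Delta t}{\varepsilon}A\,Q_P(F),$$ $$f^{n+1}=f^n+\Delta t\,\tilde w^T\left(\frac1\varepsilon G_P(F)+L(F)\right)+\frac{\Delta t}{\varepsilon}w^T Q_P(F).$$ If the scheme is of type CK and globally stiffly accurate, then for consistent initial data $f_0$, in the limit $\varepsilon\to0$ with $\Delta t$ fixed, the scheme becomes the explicit Runge-Kutta scheme characterized by $(\tilde A,\tilde w,\tilde c)$ applied to the Euler system $\partial_tU+\nabla_x\cdot\mathcal F(U)=0$. That is, for every $n\ge0$, in the limit each stage satisfies $F^{(i)}=M[F^{(i)}]$, and with $\mathcal U^{(i)}=\langle\phi F^{(i)}\rangle$, $U^n=\langle\phi f^n\rangle$, $$\mathcal U^{(i)}=U^n-\Delta t\sum_{j=1}^{i-1}\tilde a_{ij}\nabla_x\cdot\mathcal F(\mathcal U^{(j)}),\quad i=1,\dots,\nu,\qquad U^{n+1}=U^n-\Delta t\sum_{i=1}^{\nu}\tilde w_i\nabla_x\cdot\mathcal F(\mathcal U^{(i)}).$$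
   Context: Kinetic equation: $f=f(x,v,t)\ge0$, $v\in\mathbb R^3$, $x\in\Omega\subset\mathbb R^{d_x}$, $t>0$, initial datum $f_0(x,v)$, Knudsen number $\varepsilon>0$. Notation: $\langle g\rangle=\int_{\mathbb R^3}g\,dv$, $\phi(v)=(1,v,|v|^2/2)^T$. $Q_B$ is the Boltzmann collision operator $Q_B(f)=\int_{\mathbb R^3\times S^2}B(|v-v_*|,n)[f(v')f(v'_* )-f(v)f(v_* )]\,dv_*\,dn$ with collision kernel $B\ge0$ and $v',v'_*$ the standard elastic post-collisional velocities. The properties used are: $\langle\phi\,Q_B(f)\rangle=0$ for all $f$, and $Q_B(f)=0$ if and only if $f=M[f]$. Maxwellian: for a distribution $f$ with moments $(\rho,\rho u,E)^T=\langle\phi f\rangle$ and temperature $T=\frac1{3\rho}\langle|v-u|^2f\rangle$, $M[f]=\frac{\rho}{(2\pi T)^{3/2}}\exp\left(-\frac{|u-v|^2}{2T}\right)$, so $\langle\phi M[f]\rangle=\langle\phi f\rangle$. Penalization: $Q_P$ is an operator with $\langle\phi\,Q_P(f)\rangle=0$ for all $f$, and $Q_P(f)=0$ if and only if $f=M[f]$; $G_P(f)=Q_B(f)-Q_P(f)$. Euler system: $U=(\rho,\rho u,E)^T=\langle\phi M[f]\rangle$, $\mathcal F(U)=\langle v\phi M[f]\rangle=(\rho u,\rho u\otimes u+pI,Eu+pu)^T$, $p=\rho T$. Scheme: $\tilde A=(\tilde a_{ij})$, $A=(a_{ij})$ are real $\nu\times\nu$ matrices with $\tilde a_{ij}=0$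 for $j\ge i$ and $a_{ij}=0$ for $j>i$; $\tilde w,w\in\mathbb R^\nu$; $\tilde c_i=\sum_j\tilde a_{ij}$; $e=(1,\dots,1)^T\in\mathbb R^\nu$; $F=(F^{(1)},\dots,F^{(\nu)})^T$ are the stages; $L(F),G_P(F),Q_P(F)$ act componentwise, with $L(F^{(i)})=-v\cdot\nabla_xF^{(i)}$; $\Delta t>0$ is the time step; $f^0=f_0$. Type CK: $A=\begin{pmatrix} 0 & 0 \\ a & \hat A \end{pmatrix}$ with $a=(a_{21},\dots,a_{\nu1})^T\in\mathbb R^{\nu-1}$ and $\hat A\in\mathbb R^{(\nu-1)\times(\nu-1)}$ invertible. Globally stiffly accurate (GSA): $a_{\nu i}=w_i$ and $\tilde a_{\nu i}=\tilde w_i$ for $i=1,\dots,\nu$. Consistent (well prepared) initial data: $f_0(x,v)=M[f_0(x,v)]+g^\varepsilon(x,v)$ with $\lim_{\varepsilon\to0}g^\varepsilon(x,v)=0$. Convention on limits: the limit $\varepsilon\to0$ is formal. For fixed $\Delta t$, the ($\varepsilon$-dependent) numerical quantities $f^n$ and $F^{(i)}$ are assumed to converge as $\varepsilon\to0$, and $Q_P$, $G_P$, $L$, $M[\cdot]$ and the moments $\langle\cdot\rangle$ are assumed to commute with this limit; the statement is about the limiting quantities. *)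

theory Defs
  imports "Jordan_Normal_Form.Matrix" "HOL-Analysis.Analysis"
begin

no_notation Matrix.vec_index (infixl \<open>$\<close> 100)

section \<open>Velocity moments and Maxwellians\<close>

definition bracket :: "(real^3 \<Rightarrow> 'b::{banach,second_countable_topology}) \<Rightarrow> 'b" where
  "bracket g = (\<integral>v. g v \<partial>lborel)"

text \<open>States \<open>(\<rho>, \<rho> u, E)\<close> and collision invariants take values in \<open>\<real> \<times> \<real>\<^sup>3 \<times> \<real>\<close>.\<close>

type_synonym state = "real \<times> (real^3) \<times> real"

definition phi :: "real^3 \<Rightarrow> state" where
  "phi v = (1, v, (norm v)\<^sup>2 / 2)"

definition moments :: "(real^3 \<Rightarrow> real) \<Rightarrow> state" where
  "moments g = bracket (\<lambda>v. g v *\<^sub>R phi v)"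

definition density :: "(real^3 \<Rightarrow> real) \<Rightarrow> real" where
  "density g = fst (moments g)"

definition velocity :: "(real^3 \<Rightarrow> real) \<Rightarrow> real^3" where
  "velocity g = fst (snd (moments g)) /\<^sub>R density g"

definition temperature :: "(real^3 \<Rightarrow> real) \<Rightarrow> real" where
  "temperature g = 1 / (3 * density g) * bracket (\<lambda>v. (norm (v - velocity g))\<^sup>2 * g v)"

definition maxwellian :: "(real^3 \<Rightarrow> real) \<Rightarrow> (real^3 \<Rightarrow> real)" where
  "maxwellian g v = density g / (2 * pi * temperature g) powr (3/2) *
     exp (- (norm (velocity g - v))\<^sup>2 / (2 * temperature g))"

section \<open>The Boltzmann collision operator\<close>

text \<open>Surface measure on \<open>S\<^sup>2\<close>, as the cone measure: the surface area of \<open>A \<subseteq> S\<^sup>2\<close> is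
  three times the volume of \<open>{r n | 0 < r < 1, n \<in> A}\<close>.\<close>

definition sphere_measure :: "(real^3) measure" where
  "sphere_measure = scale_measure 3 (distr (restrict_space lborel (ball 0 1)) borel sgn)"

definition post_coll :: "real^3 \<Rightarrow> real^3 \<Rightarrow> real^3 \<Rightarrow> real^3" where
  "post_coll v w n = (1/2) *\<^sub>R (v + w) + (norm (v - w) / 2) *\<^sub>R n"

definition post_coll' :: "real^3 \<Rightarrow> real^3 \<Rightarrow> real^3 \<Rightarrow> real^3" where
  "post_coll' v w n = (1/2) *\<^sub>R (v + w) - (norm (v - w) / 2) *\<^sub>R n"

text \<open>The customary notation \<open>B(|v - v\<^sub>*|, n)\<close> stands for a kernel depending on \<open>|v - v\<^sub>*|\<close> and on
  the angle between \<open>n\<close> and \<open>v - v\<^sub>*\<close>; such a \<open>B\<close> is a function of the two vectors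
  \<open>v - v\<^sub>*\<close> and \<open>n\<close>, and so is one that depends on \<open>|v - v\<^sub>*|\<close> and \<open>n\<close> literally.\<close>

definition Q_boltz :: "(real^3 \<Rightarrow> real^3 \<Rightarrow> real) \<Rightarrow> (real^3 \<Rightarrow> real) \<Rightarrow> (real^3 \<Rightarrow> real)" where
  "Q_boltz B g v = (\<integral>(w, n). B (v - w) n *
     (g (post_coll v w n) * g (post_coll' v w n) - g v * g w) \<partial>(lborel \<Otimes>\<^sub>M sphere_measure))"

section \<open>Functions on phase space\<close>

type_synonym 'd phase = "real^'d \<Rightarrow> real^3 \<Rightarrow> real"

definition Q_B :: "(real^3 \<Rightarrow> real^3 \<Rightarrow> real) \<Rightarrow> 'd phase \<Rightarrow> 'd phase" where
  "Q_B B f x = Q_boltz B (f x)"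

definition G_P :: "(real^3 \<Rightarrow> real^3 \<Rightarrow> real) \<Rightarrow> ('d phase \<Rightarrow> 'd phase) \<Rightarrow> 'd phase \<Rightarrow> 'd phase" where
  "G_P B QP f x v = Q_B B f x v - QP f x v"

definition partial_deriv :: "'d::finite \<Rightarrow> (real^'d \<Rightarrow> 'b::real_normed_vector) \<Rightarrow> real^'d \<Rightarrow> 'b" where
  "partial_deriv k h x = vector_derivative (\<lambda>s. h (x + s *\<^sub>R axis k 1)) (at 0)"

definition partially_differentiable :: "'d::finite \<Rightarrow> (real^'d \<Rightarrow> 'b::real_normed_vector) \<Rightarrow> real^'d \<Rightarrow> bool" where
  "partially_differentiable k h x \<longleftrightarrow> (\<lambda>s. h (x + s *\<^sub>R axis k 1)) differentiable (at 0)"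

text \<open>The position has \<open>d\<^sub>x = CARD('d)\<close> components, the velocity three; the injection \<open>\<iota>\<close> tells which
  velocity component transports along which position coordinate (the identity if \<open>'d = 3\<close>).\<close>

definition transport :: "('d::finite \<Rightarrow> 3) \<Rightarrow> 'd phase \<Rightarrow> 'd phase" where
  "transport \<iota> f x v = - (\<Sum>k\<in>UNIV. v $ \<iota> k * partial_deriv k (\<lambda>y. f y v) x)"

text \<open>Classes of functions on which the operators of the scheme make sense: the moments of \<open>f\<close> and
  of its transport term exist, and \<open>M[f]\<close> is defined. Nonnegativity is not needed.\<close>

definition admissible_class :: "(real^'d) set \<Rightarrow> ('d::finite \<Rightarrow> 3) \<Rightarrow> 'd phase set \<Rightarrow> bool" where
  "admissible_class \<Omega> \<iota> \<D> \<longleftrightarrow> (\<forall>f\<in>\<D>. \<forall>x\<in>\<Omega>.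
     (\<forall>v k. partially_differentiable k (\<lambda>y. f y v) x) \<and>
     integrable lborel (\<lambda>v. f x v *\<^sub>R phi v) \<and>
     integrable lborel (\<lambda>v. transport \<iota> f x v *\<^sub>R phi v) \<and>
     density (f x) > 0 \<and> temperature (f x) > 0)"

text \<open>\<open>\<langle>\<phi> Q(f)\<rangle> = 0\<close>, and \<open>Q(f) = 0\<close> iff \<open>f = M[f]\<close>. The operator acts on functions of \<open>(x, v)\<close>
  and need not be local in \<open>x\<close>.\<close>

definition collision_like :: "(real^'d) set \<Rightarrow> 'd phase set \<Rightarrow> ('d phase \<Rightarrow> 'd phase) \<Rightarrow> bool" where
  "collision_like \<Omega> \<D> Q \<longleftrightarrow> (\<forall>f\<in>\<D>.
     (\<forall>x\<in>\<Omega>. has_bochner_integral lborel (\<lambda>v. Q f x v *\<^sub>R phi v) 0) \<and>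
     ((\<forall>x\<in>\<Omega>. \<forall>v. Q f x v = 0) \<longleftrightarrow> (\<forall>x\<in>\<Omega>. \<forall>v. f x v = maxwellian (f x) v)))"

section \<open>The formal limit \<open>\<epsilon> \<rightarrow> 0\<close>\<close>

definition formal_limit :: "(real^'d) set \<Rightarrow> ('d::finite \<Rightarrow> 3) \<Rightarrow> (real^3 \<Rightarrow> real^3 \<Rightarrow> real) \<Rightarrow>
    ('d phase \<Rightarrow> 'd phase) \<Rightarrow> (real \<Rightarrow> 'd phase) \<Rightarrow> 'd phase \<Rightarrow> bool" where
  "formal_limit \<Omega> \<iota> B QP f f\<^sub>0 \<longleftrightarrow> (\<forall>x\<in>\<Omega>.
     (\<forall>v. ((\<lambda>\<epsilon>. f \<epsilon> x v) \<longlongrightarrow> f\<^sub>0 x v) (at_right 0) \<and>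
          ((\<lambda>\<epsilon>. QP (f \<epsilon>) x v) \<longlongrightarrow> QP f\<^sub>0 x v) (at_right 0) \<and>
          ((\<lambda>\<epsilon>. G_P B QP (f \<epsilon>) x v) \<longlongrightarrow> G_P B QP f\<^sub>0 x v) (at_right 0) \<and>
          ((\<lambda>\<epsilon>. transport \<iota> (f \<epsilon>) x v) \<longlongrightarrow> transport \<iota> f\<^sub>0 x v) (at_right 0) \<and>
          ((\<lambda>\<epsilon>. maxwellian (f \<epsilon> x) v) \<longlongrightarrow> maxwellian (f\<^sub>0 x) v) (at_right 0)) \<and>
     ((\<lambda>\<epsilon>. moments (f \<epsilon> x)) \<longlongrightarrow> moments (f\<^sub>0 x)) (at_right 0) \<and>
     ((\<lambda>\<epsilon>. moments (transport \<iota> (f \<epsilon>) x)) \<longlongrightarrow> moments (transport \<iota> f\<^sub>0 x)) (at_right 0))"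

definition consistent_initial_data :: "(real^'d) set \<Rightarrow> (real \<Rightarrow> 'd phase) \<Rightarrow> bool" where
  "consistent_initial_data \<Omega> f\<^sub>0 \<longleftrightarrow> (\<exists>g :: real \<Rightarrow> 'd phase.
     (\<forall>\<epsilon>>0. \<forall>x\<in>\<Omega>. \<forall>v. f\<^sub>0 \<epsilon> x v = maxwellian (f\<^sub>0 \<epsilon> x) v + g \<epsilon> x v) \<and>
     (\<forall>x\<in>\<Omega>. \<forall>v. ((\<lambda>\<epsilon>. g \<epsilon> x v) \<longlongrightarrow> 0) (at_right 0)))"

section \<open>IMEX Runge--Kutta schemes\<close>

text \<open>Stages are numbered \<open>0, \<dots>, \<nu> - 1\<close>. In the definitions below \<open>At\<close>, \<open>wt\<close> are the explicit and
  \<open>A\<close>, \<open>w\<close> the implicit coefficients.\<close>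

definition imex_tableau :: "nat \<Rightarrow> real mat \<Rightarrow> real Matrix.vec \<Rightarrow> real mat \<Rightarrow> real Matrix.vec \<Rightarrow> bool" where
  "imex_tableau \<nu> At wt A w \<longleftrightarrow>
     At \<in> carrier_mat \<nu> \<nu> \<and> wt \<in> carrier_vec \<nu> \<and> A \<in> carrier_mat \<nu> \<nu> \<and> w \<in> carrier_vec \<nu> \<and>
     (\<forall>i<\<nu>. \<forall>j<\<nu>. i \<le> j \<longrightarrow> At $$ (i, j) = 0) \<and>
     (\<forall>i<\<nu>. \<forall>j<\<nu>. i < j \<longrightarrow> A $$ (i, j) = 0)"

definition type_CK :: "nat \<Rightarrow> real mat \<Rightarrow> bool" where
  "type_CK \<nu> A \<longleftrightarrow> (\<exists>a Ahat. a \<in> carrier_mat (\<nu> - 1) 1 \<and> Ahat \<in> carrier_mat (\<nu> - 1) (\<nu> - 1) \<and>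
     invertible_mat Ahat \<and> A = four_block_mat (0\<^sub>m 1 1) (0\<^sub>m 1 (\<nu> - 1)) a Ahat)"

definition globally_stiffly_accurate ::
    "nat \<Rightarrow> real mat \<Rightarrow> real Matrix.vec \<Rightarrow> real mat \<Rightarrow> real Matrix.vec \<Rightarrow> bool" where
  "globally_stiffly_accurate \<nu> At wt A w \<longleftrightarrow>
     (\<forall>i<\<nu>. A $$ (\<nu> - 1, i) = vec_index w i \<and> At $$ (\<nu> - 1, i) = vec_index wt i)"

text \<open>One step from \<open>f\<close> to \<open>f'\<close> with stages \<open>F 0, \<dots>, F (\<nu> - 1)\<close>.\<close>

definition penalized_imex_step ::
    "(real^'d) set \<Rightarrow> ('d::finite \<Rightarrow> 3) \<Rightarrow> (real^3 \<Rightarrow> real^3 \<Rightarrow> real) \<Rightarrow> ('d phase \<Rightarrow> 'd phase) \<Rightarrow>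
     nat \<Rightarrow> real mat \<Rightarrow> real Matrix.vec \<Rightarrow> real mat \<Rightarrow> real Matrix.vec \<Rightarrow> real \<Rightarrow> real \<Rightarrow>
     'd phase \<Rightarrow> (nat \<Rightarrow> 'd phase) \<Rightarrow> 'd phase \<Rightarrow> bool" where
  "penalized_imex_step \<Omega> \<iota> B QP \<nu> At wt A w \<Delta>t \<epsilon> f F f' \<longleftrightarrow> (\<forall>x\<in>\<Omega>. \<forall>v.
     (\<forall>i<\<nu>. F i x v = f x v
        + \<Delta>t * (\<Sum>j<\<nu>. At $$ (i, j) * (1 / \<epsilon> * G_P B QP (F j) x v + transport \<iota> (F j) x v))
        + \<Delta>t / \<epsilon> * (\<Sum>j<\<nu>. A $$ (i, j) * QP (F j) x v)) \<and>
     f' x v = f x v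
        + \<Delta>t * (\<Sum>j<\<nu>. vec_index wt j * (1 / \<epsilon> * G_P B QP (F j) x v + transport \<iota> (F j) x v))
        + \<Delta>t / \<epsilon> * (\<Sum>j<\<nu>. vec_index w j * QP (F j) x v))"

section \<open>The Euler system\<close>

text \<open>The \<open>l\<close>-th column of \<open>\<F>(U) = (\<rho> u, \<rho> u \<otimes> u + p I, E u + p u)\<close> with \<open>p = \<rho> T\<close>, where
  \<open>T\<close> is obtained from \<open>E = \<rho> |u|\<^sup>2 / 2 + 3 \<rho> T / 2\<close>.\<close>

definition euler_flux :: "3 \<Rightarrow> state \<Rightarrow> state" where
  "euler_flux l U = (case U of (\<rho>, m, E) \<Rightarrow>
     let u = m /\<^sub>R \<rho>; T = (2 * E / \<rho> - (norm u)\<^sup>2) / 3; p = \<rho> * T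
     in (\<rho> * u $ l, (\<rho> * u $ l) *\<^sub>R u + p *\<^sub>R axis l 1, E * u $ l + p * u $ l))"

definition div_euler_flux :: "('d::finite \<Rightarrow> 3) \<Rightarrow> (real^'d \<Rightarrow> state) \<Rightarrow> real^'d \<Rightarrow> state" where
  "div_euler_flux \<iota> U x = (\<Sum>k\<in>UNIV. partial_deriv k (\<lambda>y. euler_flux (\<iota> k) (U y)) x)"

text \<open>One step of the explicit Runge--Kutta scheme. The differentiability clause ensures that the
  derivatives in the divergences exist. The abscissae \<open>\<Sum>\<^sub>j At\<^sub>i\<^sub>j\<close> play no role, the
  system being autonomous.\<close>

definition explicit_RK_euler_step ::
    "(real^'d) set \<Rightarrow> ('d::finite \<Rightarrow> 3) \<Rightarrow> nat \<Rightarrow> real mat \<Rightarrow> real Matrix.vec \<Rightarrow> real \<Rightarrow>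
     (real^'d \<Rightarrow> state) \<Rightarrow> (nat \<Rightarrow> real^'d \<Rightarrow> state) \<Rightarrow> (real^'d \<Rightarrow> state) \<Rightarrow> bool" where
  "explicit_RK_euler_step \<Omega> \<iota> \<nu> At wt \<Delta>t U Us U' \<longleftrightarrow> (\<forall>x\<in>\<Omega>.
     (\<forall>i<\<nu>. \<forall>k. partially_differentiable k (\<lambda>y. euler_flux (\<iota> k) (Us i y)) x) \<and>
     (\<forall>i<\<nu>. Us i x = U x - \<Delta>t *\<^sub>R (\<Sum>j<i. At $$ (i, j) *\<^sub>R div_euler_flux \<iota> (Us j) x)) \<and>
     U' x = U x - \<Delta>t *\<^sub>R (\<Sum>i<\<nu>. vec_index wt i *\<^sub>R div_euler_flux \<iota> (Us i) x))"

end

theory Submission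
  imports Defs "HOL-Probability.Distributions" "Jordan_Normal_Form.Determinant"
begin

text \<open>At the level of the moments the scheme is explicit for every \<open>\<epsilon> > 0\<close>: the operators
  \<open>Q\<^sub>B\<close> and \<open>Q\<^sub>P\<close> have vanishing moments, so the terms of size \<open>1 / \<epsilon>\<close> drop out of the moments
  of every stage (\<open>moments_penalized_combination\<close>) and only those of the transport term remain.
  The limit therefore turns into the explicit Runge--Kutta scheme for the Euler system as soon as the
  limiting stages are Maxwellian, because the moments of the transport term of a Maxwellian are
  minus the divergence of the Euler flux (\<open>moments_transport_maxwellian\<close>).

  The stages become Maxwellian by an induction over steps and stages. Multiplying the equation of a
  stage by \<open>\<epsilon>\<close> and letting \<open>\<epsilon> \<rightarrow> 0\<close> leaves a balance between the \<open>G\<^sub>P\<close>-values and the \<open>Q\<^sub>P\<close>-values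
  of the limiting stages (\<open>stiff_limit_balance\<close>). If the earlier stages are Maxwellian they
  contribute nothing, and the balance reduces to \<open>a\<^sub>i\<^sub>i Q\<^sub>P(F\<^sup>(\<^sup>i\<^sup>)) = 0\<close>; for type CK the diagonal
  entry is nonzero in every row but the first (\<open>type_CK_diagonal_nonzero\<close>), so the stage is
  Maxwellian as well. The first row vanishes, so the first stage equals \<open>f\<^sup>n\<close>; it is Maxwellian at
  \<open>n = 0\<close> by consistency of the initial data and later because global stiff accuracy makes
  \<open>f\<^sup>n\<^sup>+\<^sup>1\<close> equal to the last stage.

  The analytic part is the differentiation of the flux \<open>\<langle>v \<phi> M[f]\<rangle>\<close> with respect to \<open>x\<close>, which has to
  be carried under the integral although \<open>f\<close> is only known to be differentiable in \<open>x\<close> for each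
  fixed \<open>v\<close>, without any uniformity. For Maxwellians this is enough. The logarithm of a Maxwellian is a
  linear combination \<open>\<theta> \<bullet> \<phi>(v)\<close> of the collision invariants, so pointwise differentiability at a
  few velocities already makes the coefficients \<open>\<theta>\<close> differentiable
  (\<open>differentiable_of_inner_phi\<close>), and a Gaussian bound on the difference quotients then allows
  dominated convergence (\<open>has_vector_derivative_integral_exp_inner_phi\<close>). The flux itself is
  identified with \<open>\<F>(U)\<close> by symmetry of the centred Gaussian (\<open>integral_flux_maxwellian\<close>).\<close>

no_notation Matrix.vec_index (infixl \<open>$\<close> 100)
no_notation Matrix.scalar_prod (infix \<open>\<bullet>\<close> 70)

section \<open>Integrability of Gaussians times polynomials\<close>

lemma nn_integral_gaussian_1d:
  fixes c :: real
  assumes "c > 0"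
  shows "(\<integral>\<^sup>+x. ennreal (exp (- c * x\<^sup>2)) \<partial>lborel) < \<infinity>"
proof -
  define \<sigma> where "\<sigma> = sqrt (1 / (2 * c))"
  have \<sigma>: "\<sigma> > 0" "2 * \<sigma>\<^sup>2 = 1 / c" using assms by (simp_all add: \<sigma>_def)
  have "integrable lborel (\<lambda>x. sqrt (2 * pi * \<sigma>\<^sup>2) * normal_density 0 \<sigma> x)"
    using \<sigma>(1) by simp
  moreover have "(\<lambda>x. sqrt (2 * pi * \<sigma>\<^sup>2) * normal_density 0 \<sigma> x) = (\<lambda>x. exp (- c * x\<^sup>2))"
    using \<sigma> by (simp add: normal_density_def fun_eq_iff)
  ultimately have "integrable lborel (\<lambda>x. exp (- c * x\<^sup>2))" by simp
  then show ?thesis by (simp add: integrable_iff_bounded)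
qed

lemma integrable_gaussian:
  fixes c :: real
  assumes "c > 0"
  shows "integrable lborel (\<lambda>v::'a::euclidean_space. exp (- c * (norm v)\<^sup>2))"
proof -
  have "(norm v)\<^sup>2 = (\<Sum>b\<in>Basis. (v \<bullet> b)\<^sup>2)" for v :: 'a
    by (subst power2_norm_eq_inner, subst euclidean_inner) (simp add: power2_eq_square)
  then have "(\<lambda>v::'a. ennreal (exp (- c * (norm v)\<^sup>2))) = (\<lambda>v. ennreal (\<Prod>b\<in>Basis. exp (- c * (v \<bullet> b)\<^sup>2)))"
    by (simp add: exp_sum[OF finite_Basis, symmetric] sum_distrib_left[symmetric] sum_negf)
  then have "(\<integral>\<^sup>+(v::'a). ennreal (exp (- c * (norm v)\<^sup>2)) \<partial>lborel)
      = (\<integral>\<^sup>+(v::'a). (\<Prod>b\<in>Basis. ennreal (exp (- c * (v \<bullet> b)\<^sup>2))) \<partial>lborel)"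
    by (simp add: prod_ennreal)
  also have "\<dots> = (\<Prod>b\<in>(Basis::'a set). \<integral>\<^sup>+x. ennreal (exp (- c * x\<^sup>2)) \<partial>lborel)"
    by (rule nn_integral_lborel_prod) auto
  also have "\<dots> < \<infinity>"
    using nn_integral_gaussian_1d[OF assms] by (simp add: power_less_top_ennreal)
  finally show ?thesis by (intro integrableI_bounded) simp_all
qed

text \<open>Completing the square absorbs the linear part of the exponent, and the exponential series
  turns the polynomial into another linear exponent. The exponent depends on the norm of \<open>v\<close> only, so
  that a single such function dominates all Maxwellians with nearby parameters.\<close>

lemma integrable_gaussian_poly:
  fixes a b c :: real
  assumes "c > 0"
  shows "integrable lborel
    (\<lambda>v::'a::euclidean_space. exp (a + b * norm v - c * (norm v)\<^sup>2) * (1 + norm v) ^ n)"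
proof (rule Bochner_Integration.integrable_bound)
  define d where "d = c / 2"
  define K where "K = fact n * exp (a + 1 + (b + 1)\<^sup>2 / (4 * d))"
  have d: "d > 0" "c = 2 * d" using assms by (simp_all add: d_def)
  show "integrable lborel (\<lambda>v::'a. K * exp (- d * (norm v)\<^sup>2))"
    by (intro integrable_mult_right integrable_gaussian d(1))
  have "exp (a + b * r - c * r\<^sup>2) * (1 + r) ^ n \<le> K * exp (- d * r\<^sup>2)" if "r \<ge> 0" for r :: real
  proof -
    have "(1 + r) ^ n / fact n \<le> exp (1 + r)"
    proof -
      have "(\<Sum>k\<in>{n}. (1 + r) ^ k /\<^sub>R fact k) \<le> (\<Sum>k. (1 + r) ^ k /\<^sub>R fact k)"
        using that by (intro sum_le_suminf) (auto intro!: summable_exp)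
      then show ?thesis by (simp add: exp_def field_simps)
    qed
    then have "(1 + r) ^ n \<le> fact n * exp (1 + r)" by (simp add: field_simps)
    then have "exp (a + b * r - c * r\<^sup>2) * (1 + r) ^ n \<le> exp (a + b * r - c * r\<^sup>2) * (fact n * exp (1 + r))"
      by (intro mult_left_mono) auto
    also have "\<dots> = fact n * exp (a + 1 + (b + 1) * r - c * r\<^sup>2)"
      by (simp add: exp_add[symmetric] algebra_simps)
    also have "\<dots> \<le> fact n * exp (a + 1 + (b + 1)\<^sup>2 / (4 * d) - d * r\<^sup>2)"
    proof -
      have "0 \<le> (b + 1 - 2 * d * r)\<^sup>2 / (4 * d)" using d by simp
      also have "\<dots> = (b + 1)\<^sup>2 / (4 * d) - (b + 1) * r + d * r\<^sup>2"
        using d(1) by (simp add: field_simps power2_eq_square)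
      finally show ?thesis using d(2) by (intro mult_left_mono) auto
    qed
    also have "\<dots> = K * exp (- d * r\<^sup>2)"
      by (simp add: K_def exp_add[symmetric])
    finally show ?thesis .
  qed
  then show "AE v::'a in lborel. norm (exp (a + b * norm v - c * (norm v)\<^sup>2) * (1 + norm v) ^ n)
      \<le> norm (K * exp (- d * (norm v)\<^sup>2))"
    by (intro AE_I2) (simp add: K_def abs_mult)
qed simp

section \<open>Exponentials of collision invariants\<close>

lemma norm_phi_le: "norm (phi v) \<le> (1 + norm v)\<^sup>2"
proof -
  have "norm (phi v) \<le> norm (1::real) + (norm v + norm ((norm v)\<^sup>2 / 2))"
    unfolding phi_def
    by (rule order_trans[OF norm_Pair_le add_left_mono[OF norm_Pair_le]])
  also have "\<dots> \<le> (1 + norm v)\<^sup>2" by (simp add: power2_eq_square field_simps)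
  finally show ?thesis .
qed

lemma measurable_phi [measurable]: "phi \<in> borel_measurable borel"
  unfolding phi_def[abs_def] by (intro borel_measurable_continuous_onI continuous_intros) auto

lemma inner_phi: "\<theta> \<bullet> phi v = fst \<theta> + fst (snd \<theta>) \<bullet> v + snd (snd \<theta>) * ((norm v)\<^sup>2 / 2)"
  by (simp add: phi_def inner_prod_def)

lemma inner_phi_le:
  "\<theta> \<bullet> phi v \<le> norm \<theta> + norm \<theta> * norm v - (- snd (snd \<theta>) / 2) * (norm v)\<^sup>2"
proof -
  have "fst \<theta> \<le> norm \<theta>" by (metis abs_le_D1 norm_fst_le real_norm_def prod.collapse)
  moreover have "norm (fst (snd \<theta>)) \<le> norm \<theta>"
    by (metis norm_fst_le norm_snd_le order_trans prod.collapse)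
  then have "fst (snd \<theta>) \<bullet> v \<le> norm \<theta> * norm v"
    by (meson mult_right_mono norm_cauchy_schwarz norm_ge_zero order_trans)
  ultimately show ?thesis by (simp add: inner_phi)
qed

lemma integrable_exp_inner_phi:
  fixes \<psi> :: "real^3 \<Rightarrow> 'b::{banach,second_countable_topology}"
  assumes "snd (snd \<theta>) < 0" and [measurable]: "\<psi> \<in> borel_measurable borel"
    and \<psi>: "\<And>v. norm (\<psi> v) \<le> K * (1 + norm v) ^ n"
  shows "integrable lborel (\<lambda>v. exp (\<theta> \<bullet> phi v) *\<^sub>R \<psi> v)"
proof (rule Bochner_Integration.integrable_bound)
  let ?g = "\<lambda>v::real^3. exp (norm \<theta> + norm \<theta> * norm v - (- snd (snd \<theta>) / 2) * (norm v)\<^sup>2) * (1 + norm v) ^ n"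
  show "integrable lborel (\<lambda>v. K * ?g v)"
    using integrable_gaussian_poly[of "- snd (snd \<theta>) / 2", where ?'a = "real^3"] assms(1)
    by (intro integrable_mult_right) simp
  show "AE v in lborel. norm (exp (\<theta> \<bullet> phi v) *\<^sub>R \<psi> v) \<le> norm (K * ?g v)"
  proof (rule AE_I2)
    fix v
    have "norm (exp (\<theta> \<bullet> phi v) *\<^sub>R \<psi> v) \<le> exp (norm \<theta> + norm \<theta> * norm v - (- snd (snd \<theta>) / 2) * (norm v)\<^sup>2) * (K * (1 + norm v) ^ n)"
      using inner_phi_le[of \<theta> v] \<psi>[of v] by (auto intro!: mult_mono)
    then show "norm (exp (\<theta> \<bullet> phi v) *\<^sub>R \<psi> v) \<le> norm (K * ?g v)" by (simp add: mult_ac)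
  qed
qed simp

lemma has_vector_derivative_iff_quotient:
  fixes h :: "real \<Rightarrow> 'b::real_normed_vector"
  shows "(h has_vector_derivative D) (at 0) \<longleftrightarrow> ((\<lambda>s. (h s - h 0) /\<^sub>R s) \<longlongrightarrow> D) (at 0)"
proof -
  have "(h has_vector_derivative D) (at 0) \<longleftrightarrow> ((\<lambda>s. norm (h s - h 0 - s *\<^sub>R D) / norm s) \<longlongrightarrow> 0) (at 0)"
    by (simp add: has_vector_derivative_def has_derivative_at bounded_linear_scaleR_left)
  also have "\<dots> \<longleftrightarrow> ((\<lambda>s. norm ((h s - h 0) /\<^sub>R s - D)) \<longlongrightarrow> 0) (at 0)"
  proof (intro filterlim_cong refl)
    have "norm (h s - h 0 - s *\<^sub>R D) / norm s = norm ((h s - h 0) /\<^sub>R s - D)" if "s \<noteq> 0" for s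
    proof -
      have "(h s - h 0) /\<^sub>R s - D = (h s - h 0 - s *\<^sub>R D) /\<^sub>R s"
        using that by (simp add: scaleR_diff_right)
      then show ?thesis by (simp add: divide_inverse mult.commute)
    qed
    then show "\<forall>\<^sub>F s in at 0. norm (h s - h 0 - s *\<^sub>R D) / norm s = norm ((h s - h 0) /\<^sub>R s - D)"
      by (auto simp: eventually_at_filter)
  qed
  also have "\<dots> \<longleftrightarrow> ((\<lambda>s. (h s - h 0) /\<^sub>R s) \<longlongrightarrow> D) (at 0)"
    by (simp add: tendsto_norm_zero_iff LIM_zero_iff)
  finally show ?thesis .
qed

text \<open>The bound \<open>m\<close> on both exponents lets the difference quotients of a family of Gaussians be
  dominated by one Gaussian.\<close>

lemma exp_diff_le:
  fixes a b :: real
  assumes "a \<le> m" "b \<le> m"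
  shows "\<bar>exp a - exp b\<bar> \<le> \<bar>a - b\<bar> * exp m"
proof -
  have *: "exp y - exp x \<le> (y - x) * exp m" if "x \<le> y" "y \<le> m" for x y :: real
  proof -
    have "exp y * (1 + (x - y)) \<le> exp y * exp (x - y)"
      by (intro mult_left_mono exp_ge_add_one_self) auto
    then have "exp y - exp x \<le> (y - x) * exp y"
      by (simp add: exp_add[symmetric] algebra_simps)
    also have "\<dots> \<le> (y - x) * exp m" using that by (intro mult_left_mono) auto
    finally show ?thesis .
  qed
  show ?thesis using *[of a b] *[of b a] assms
    by (cases "a \<le> b") (auto simp: abs_if)
qed

text \<open>Differentiability of the parameters at the single point \<open>0\<close> suffices: near \<open>0\<close> the
  difference quotients of \<open>\<theta>\<close> are bounded and the coefficient of \<open>|v|\<^sup>2\<close> stays away from zero, so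
  the quotients of the integrand are dominated by a Gaussian times a polynomial.\<close>

lemma has_vector_derivative_integral_exp_inner_phi:
  fixes \<psi> :: "real^3 \<Rightarrow> 'b::{banach,second_countable_topology}"
  assumes \<theta>: "(\<theta> has_vector_derivative \<theta>') (at 0)" and neg: "snd (snd (\<theta> 0)) < 0"
    and [measurable]: "\<psi> \<in> borel_measurable borel"
    and \<psi>: "\<And>v. norm (\<psi> v) \<le> K * (1 + norm v) ^ n"
  shows "((\<lambda>s. \<integral>v. exp (\<theta> s \<bullet> phi v) *\<^sub>R \<psi> v \<partial>lborel) has_vector_derivative
     (\<integral>v. ((\<theta>' \<bullet> phi v) * exp (\<theta> 0 \<bullet> phi v)) *\<^sub>R \<psi> v \<partial>lborel)) (at 0)"
proof -
  \<comment> \<open>Half of the decay rate of the Gaussian at \<open>0\<close>; the rest is room for the parameters to move.\<close>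
  define c where "c = - snd (snd (\<theta> 0)) / 4"
  define C where "C = norm \<theta>' + 1"
  define R where "R = norm (\<theta> 0) + 1"
  have c: "c > 0" using neg by (simp add: c_def)
  define W where "W v = C * K * (exp (R + R * norm v - c * (norm v)\<^sup>2) * (1 + norm v) ^ (n + 2))" for v :: "real^3"
  have intW: "integrable lborel W"
    unfolding W_def using c by (intro integrable_mult_right integrable_gaussian_poly)
  have quot: "((\<lambda>s. (\<theta> s - \<theta> 0) /\<^sub>R s) \<longlongrightarrow> \<theta>') (at 0)"
    using \<theta> has_vector_derivative_iff_quotient by blast
  have cont: "(\<theta> \<longlongrightarrow> \<theta> 0) (at 0)"
    using has_vector_derivative_continuous[OF \<theta>] by (simp add: isCont_def)
  have "\<forall>\<^sub>F s in at 0. norm ((\<theta> s - \<theta> 0) /\<^sub>R s) < C"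
    by (rule order_tendstoD[OF tendsto_norm[OF quot]]) (simp add: C_def)
  moreover have "\<forall>\<^sub>F s in at 0. norm (\<theta> s) < R"
    by (rule order_tendstoD[OF tendsto_norm[OF cont]]) (simp add: R_def)
  moreover have "\<forall>\<^sub>F s in at 0. snd (snd (\<theta> s)) < - 2 * c"
    by (rule order_tendstoD[OF tendsto_snd[OF tendsto_snd[OF cont]]]) (use neg in \<open>simp add: c_def\<close>)
  ultimately have bound: "\<forall>\<^sub>F s in at 0. \<forall>v.
      norm (((exp (\<theta> s \<bullet> phi v) - exp (\<theta> 0 \<bullet> phi v)) / s) *\<^sub>R \<psi> v) \<le> W v"
  proof eventually_elim
    case (elim s)
    show ?case
    proof
      fix v :: "real^3"
      let ?m = "R + R * norm v - c * (norm v)\<^sup>2"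
      have m: "\<eta> \<bullet> phi v \<le> ?m" if "norm \<eta> \<le> R" "snd (snd \<eta>) \<le> - 2 * c" for \<eta>
      proof -
        have "norm \<eta> * norm v \<le> R * norm v" using that by (intro mult_right_mono) auto
        moreover have "c * (norm v)\<^sup>2 \<le> (- snd (snd \<eta>) / 2) * (norm v)\<^sup>2"
          using that by (intro mult_right_mono) auto
        ultimately show ?thesis using inner_phi_le[of \<eta> v] that by linarith
      qed
      have "\<bar>exp (\<theta> s \<bullet> phi v) - exp (\<theta> 0 \<bullet> phi v)\<bar> \<le> \<bar>\<theta> s \<bullet> phi v - \<theta> 0 \<bullet> phi v\<bar> * exp ?m"
        using elim neg c by (intro exp_diff_le m) (auto simp: R_def c_def)
      then have "\<bar>(exp (\<theta> s \<bullet> phi v) - exp (\<theta> 0 \<bullet> phi v)) / s\<bar>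
          \<le> \<bar>((\<theta> s - \<theta> 0) /\<^sub>R s) \<bullet> phi v\<bar> * exp ?m"
        by (simp add: abs_mult inner_diff_left divide_inverse mult_ac mult_left_mono)
      also have "\<dots> \<le> (C * (1 + norm v)\<^sup>2) * exp ?m"
      proof (intro mult_right_mono)
        have "\<bar>((\<theta> s - \<theta> 0) /\<^sub>R s) \<bullet> phi v\<bar> \<le> norm ((\<theta> s - \<theta> 0) /\<^sub>R s) * norm (phi v)"
          by (rule Cauchy_Schwarz_ineq2)
        also have "\<dots> \<le> C * (1 + norm v)\<^sup>2"
          using elim(1) norm_phi_le[of v] by (intro mult_mono) (auto simp: C_def)
        finally show "\<bar>((\<theta> s - \<theta> 0) /\<^sub>R s) \<bullet> phi v\<bar> \<le> C * (1 + norm v)\<^sup>2" .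
      qed auto
      finally have "norm (((exp (\<theta> s \<bullet> phi v) - exp (\<theta> 0 \<bullet> phi v)) / s) *\<^sub>R \<psi> v)
          \<le> ((C * (1 + norm v)\<^sup>2) * exp ?m) * (K * (1 + norm v) ^ n)"
        unfolding norm_scaleR by (intro mult_mono \<psi>) (auto simp: C_def)
      then show "norm (((exp (\<theta> s \<bullet> phi v) - exp (\<theta> 0 \<bullet> phi v)) / s) *\<^sub>R \<psi> v) \<le> W v"
        by (simp add: W_def power_add power2_eq_square mult_ac)
    qed
  qed
  have "((\<lambda>s. \<integral>v. ((exp (\<theta> s \<bullet> phi v) - exp (\<theta> 0 \<bullet> phi v)) / s) *\<^sub>R \<psi> v \<partial>lborel) \<longlongrightarrow>
      (\<integral>v. ((\<theta>' \<bullet> phi v) * exp (\<theta> 0 \<bullet> phi v)) *\<^sub>R \<psi> v \<partial>lborel)) (at 0)"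
    unfolding tendsto_at_iff_sequentially comp_def
  proof (intro allI impI)
    fix X :: "nat \<Rightarrow> real"
    assume X: "\<forall>i. X i \<in> UNIV - {0}" "X \<longlonglongrightarrow> 0"
    then have X0: "filterlim X (at 0) sequentially" by (simp add: filterlim_at)
    obtain N where N: "\<And>i v. i \<ge> N \<Longrightarrow>
        norm (((exp (\<theta> (X i) \<bullet> phi v) - exp (\<theta> 0 \<bullet> phi v)) / X i) *\<^sub>R \<psi> v) \<le> W v"
      using filterlim_iff[THEN iffD1, OF X0, rule_format, OF bound]
      by (auto simp: eventually_sequentially)
    show "(\<lambda>i. \<integral>v. ((exp (\<theta> (X i) \<bullet> phi v) - exp (\<theta> 0 \<bullet> phi v)) / X i) *\<^sub>R \<psi> v \<partial>lborel) \<longlonglongrightarrow>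
       (\<integral>v. ((\<theta>' \<bullet> phi v) * exp (\<theta> 0 \<bullet> phi v)) *\<^sub>R \<psi> v \<partial>lborel)"
    proof (rule LIMSEQ_offset[where k = N], rule integral_dominated_convergence[where w = W])
      show "integrable lborel W" by (rule intW)
      show "AE v in lborel. (\<lambda>i. ((exp (\<theta> (X (i + N)) \<bullet> phi v) - exp (\<theta> 0 \<bullet> phi v)) / X (i + N)) *\<^sub>R \<psi> v)
        \<longlonglongrightarrow> ((\<theta>' \<bullet> phi v) * exp (\<theta> 0 \<bullet> phi v)) *\<^sub>R \<psi> v"
      proof (intro AE_I2 tendsto_scaleR tendsto_const)
        fix v
        have "((\<lambda>s. \<theta> s \<bullet> phi v) has_real_derivative \<theta>' \<bullet> phi v) (at 0)"
          unfolding has_real_derivative_iff_has_vector_derivative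
          by (rule bounded_linear.has_vector_derivative[OF bounded_linear_inner_left \<theta>])
        then have "((\<lambda>s. exp (\<theta> s \<bullet> phi v)) has_real_derivative exp (\<theta> 0 \<bullet> phi v) * (\<theta>' \<bullet> phi v)) (at 0)"
          by (rule DERIV_fun_exp)
        then have "((\<lambda>s. (exp (\<theta> s \<bullet> phi v) - exp (\<theta> 0 \<bullet> phi v)) / s) \<longlongrightarrow> (\<theta>' \<bullet> phi v) * exp (\<theta> 0 \<bullet> phi v)) (at 0)"
          by (simp add: has_field_derivative_iff mult.commute)
        from LIMSEQ_ignore_initial_segment[OF filterlim_compose[OF this X0], of N]
        show "(\<lambda>i. (exp (\<theta> (X (i + N)) \<bullet> phi v) - exp (\<theta> 0 \<bullet> phi v)) / X (i + N))
          \<longlonglongrightarrow> (\<theta>' \<bullet> phi v) * exp (\<theta> 0 \<bullet> phi v)" .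
      qed
    qed (use N in auto)
  qed
  moreover have "\<forall>\<^sub>F s in at 0. (\<integral>v. ((exp (\<theta> s \<bullet> phi v) - exp (\<theta> 0 \<bullet> phi v)) / s) *\<^sub>R \<psi> v \<partial>lborel)
     = ((\<integral>v. exp (\<theta> s \<bullet> phi v) *\<^sub>R \<psi> v \<partial>lborel) - (\<integral>v. exp (\<theta> 0 \<bullet> phi v) *\<^sub>R \<psi> v \<partial>lborel)) /\<^sub>R s"
    using order_tendstoD(2)[OF tendsto_snd[OF tendsto_snd[OF cont]] neg]
  proof eventually_elim
    case (elim s)
    have int: "integrable lborel (\<lambda>v. exp (\<theta> s \<bullet> phi v) *\<^sub>R \<psi> v)" "integrable lborel (\<lambda>v. exp (\<theta> 0 \<bullet> phi v) *\<^sub>R \<psi> v)"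
      using elim neg \<psi> by (auto intro!: integrable_exp_inner_phi)
    have "((exp (\<theta> s \<bullet> phi v) - exp (\<theta> 0 \<bullet> phi v)) / s) *\<^sub>R \<psi> v
       = (exp (\<theta> s \<bullet> phi v) *\<^sub>R \<psi> v - exp (\<theta> 0 \<bullet> phi v) *\<^sub>R \<psi> v) /\<^sub>R s" for v
      by (simp add: scaleR_diff_left[symmetric] divide_inverse mult.commute)
    then show ?case using int by (simp add: Bochner_Integration.integral_diff)
  qed
  ultimately show ?thesis
    unfolding has_vector_derivative_iff_quotient by (rule Lim_transform_eventually)
qed

text \<open>A quadratic polynomial \<open>\<alpha> + \<beta> \<bullet> v + \<gamma> |v|\<^sup>2 / 2\<close> is determined linearly by its values at
  \<open>0\<close> and at the vectors \<open>b\<close> of an orthonormal basis and their negatives.\<close>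

lemma differentiable_of_inner_phi:
  fixes \<theta> :: "real \<Rightarrow> state"
  assumes "\<And>v. (\<lambda>s. \<theta> s \<bullet> phi v) differentiable (at t)"
  shows "\<theta> differentiable (at t)"
proof -
  let ?L = "\<lambda>v s. \<theta> s \<bullet> phi v"
  have fst: "(\<lambda>s. fst (\<theta> s)) = ?L 0" by (simp add: inner_phi fun_eq_iff)
  obtain b :: "real^3" where b: "norm b = 1" using vector_choose_size[of 1] by auto
  have "(\<lambda>s. snd (snd (\<theta> s))) = (\<lambda>s. ?L b s + ?L (- b) s - 2 * ?L 0 s)"
    using b by (auto simp: inner_phi fun_eq_iff)
  then have snd: "(\<lambda>s. snd (snd (\<theta> s))) differentiable (at t)"
    using assms by simp
  have mid: "(\<lambda>s. fst (snd (\<theta> s))) = (\<lambda>s. \<Sum>b\<in>Basis. ((?L b s - ?L (- b) s) / 2) *\<^sub>R b)"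
    by (simp add: inner_phi fun_eq_iff euclidean_representation)
  have "(\<lambda>s. fst (snd (\<theta> s))) differentiable (at t)"
    unfolding mid using assms by (intro differentiable_sum differentiable_scaleR) auto
  moreover have "(\<lambda>s. fst (\<theta> s)) differentiable (at t)" unfolding fst by (rule assms)
  ultimately have "(\<lambda>s. (fst (\<theta> s), fst (snd (\<theta> s)), snd (snd (\<theta> s)))) differentiable (at t)"
    using snd unfolding differentiable_def by (fast intro: has_derivative_Pair)
  then show ?thesis by simp
qed

section \<open>Symmetry of the centred Gaussian\<close>

lemma integral_lborel_sign_flip:
  fixes h :: "'a::euclidean_space \<Rightarrow> 'b::{banach,second_countable_topology}"
  assumes [measurable]: "h \<in> borel_measurable borel" and \<sigma>: "\<And>b. b \<in> Basis \<Longrightarrow> \<bar>\<sigma> b\<bar> = (1::real)"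
  shows "(\<integral>w. h (\<Sum>b\<in>Basis. (\<sigma> b * (w \<bullet> b)) *\<^sub>R b) \<partial>lborel) = integral\<^sup>L lborel h"
proof -
  let ?T = "\<lambda>w::'a. 0 + (\<Sum>b\<in>Basis. (\<sigma> b * (w \<bullet> b)) *\<^sub>R b)"
  have "\<sigma> b \<noteq> 0" if "b \<in> Basis" for b using \<sigma>[OF that] by auto
  from lborel_affine_euclidean[of \<sigma> 0, OF this]
  have "lborel = distr lborel borel ?T" using \<sigma> by (simp add: density_1)
  then have "integral\<^sup>L lborel h = integral\<^sup>L (distr lborel borel ?T) h" by (rule arg_cong)
  then show ?thesis by (simp add: integral_distr)
qed

lemma integral_lborel_odd:
  fixes h :: "'a::euclidean_space \<Rightarrow> 'b::{banach,second_countable_topology}"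
  assumes [measurable]: "h \<in> borel_measurable borel" and "\<And>w. h (- w) = - h w"
  shows "integral\<^sup>L lborel h = 0"
proof -
  have "(\<Sum>b\<in>Basis. (- 1 * (w \<bullet> b)) *\<^sub>R b) = - w" for w :: 'a
    by (simp add: sum_negf euclidean_representation)
  then have "(\<integral>w. h (- w) \<partial>lborel) = integral\<^sup>L lborel h"
    using integral_lborel_sign_flip[of h "\<lambda>_. - 1"] by simp
  then have "- integral\<^sup>L lborel h = integral\<^sup>L lborel h" using assms(2) by simp
  then have "2 *\<^sub>R integral\<^sup>L lborel h = 0" by (metis add.right_inverse scaleR_2)
  then show ?thesis by simp
qed

lemma integral_lborel_odd_coordinate:
  fixes h :: "'a::euclidean_space \<Rightarrow> 'b::{banach,second_countable_topology}"
  assumes [measurable]: "h \<in> borel_measurable borel" and a: "a \<in> Basis"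
    and "\<And>w. h (w - (2 * (w \<bullet> a)) *\<^sub>R a) = - h w"
  shows "integral\<^sup>L lborel h = 0"
proof -
  have "(\<Sum>b\<in>Basis. ((if b = a then - 1 else 1) * (w \<bullet> b)) *\<^sub>R b) = w - (2 * (w \<bullet> a)) *\<^sub>R a" for w :: 'a
  proof (rule euclidean_eqI)
    fix c :: 'a
    assume c: "c \<in> Basis"
    show "(\<Sum>b\<in>Basis. ((if b = a then - 1 else 1) * (w \<bullet> b)) *\<^sub>R b) \<bullet> c = (w - (2 * (w \<bullet> a)) *\<^sub>R a) \<bullet> c"
      unfolding inner_sum_left_Basis[OF c] inner_diff_left inner_scaleR_left inner_Basis[OF a c] by simp
  qed
  then have "(\<integral>w. h (w - (2 * (w \<bullet> a)) *\<^sub>R a) \<partial>lborel) = integral\<^sup>L lborel h"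
    using integral_lborel_sign_flip[of h "\<lambda>b. if b = a then - 1 else 1"] by simp
  then have "- integral\<^sup>L lborel h = integral\<^sup>L lborel h" using assms(3) by simp
  then have "2 *\<^sub>R integral\<^sup>L lborel h = 0" by (metis add.right_inverse scaleR_2)
  then show ?thesis by simp
qed

lemma integral_lborel_translate:
  fixes h :: "'a::euclidean_space \<Rightarrow> 'b::{banach,second_countable_topology}"
  assumes [measurable]: "h \<in> borel_measurable borel"
  shows "(\<integral>v. h (v - u) \<partial>lborel) = integral\<^sup>L lborel h"
proof -
  have "integral\<^sup>L lborel h = integral\<^sup>L (distr lborel borel ((+) (- u))) h"
    by (simp only: lborel_distr_plus)
  also have "\<dots> = (\<integral>v. h (- u + v) \<partial>lborel)" by (rule integral_distr) simp_all
  finally show ?thesis by simp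
qed

text \<open>Both integrals factor over the coordinates into the same one-dimensional integrals: one
  second moment and total masses in the remaining directions.\<close>

lemma gaussian_second_moment_diagonal:
  fixes a a' :: "'a::euclidean_space"
  assumes "a \<in> Basis" "a' \<in> Basis"
  shows "(\<integral>w. (w \<bullet> a)\<^sup>2 * exp (- c * (norm w)\<^sup>2) \<partial>lborel) = (\<integral>w. (w \<bullet> a')\<^sup>2 * exp (- c * (norm w)\<^sup>2) \<partial>lborel)"
proof -
  define p where "p = (\<integral>\<^sup>+x. ennreal (x\<^sup>2 * exp (- c * x\<^sup>2)) \<partial>lborel)"
  define q where "q = (\<integral>\<^sup>+x. ennreal (exp (- c * x\<^sup>2)) \<partial>lborel)"
  have *: "(\<integral>\<^sup>+w. ennreal ((w \<bullet> a)\<^sup>2 * exp (- c * (norm w)\<^sup>2)) \<partial>lborel) = p * q ^ (card (Basis :: 'a set) - 1)"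
    if a: "a \<in> Basis" for a :: 'a
  proof -
    define F where "F b x = (if b = a then x\<^sup>2 else 1) * exp (- c * x\<^sup>2)" for b and x :: real
    have norm2: "(norm w)\<^sup>2 = (\<Sum>b\<in>Basis. (w \<bullet> b)\<^sup>2)" for w :: 'a
      by (subst power2_norm_eq_inner, subst euclidean_inner) (simp add: power2_eq_square)
    have "(w \<bullet> a)\<^sup>2 * exp (- c * (norm w)\<^sup>2) = (\<Prod>b\<in>Basis. F b (w \<bullet> b))" for w
    proof -
      have "(\<Prod>b\<in>Basis. F b (w \<bullet> b)) = (\<Prod>b\<in>Basis. if b = a then (w \<bullet> a)\<^sup>2 else 1) * (\<Prod>b\<in>Basis. exp (- c * (w \<bullet> b)\<^sup>2))"
        unfolding F_def prod.distrib by (intro arg_cong2[where f = "(*)"] prod.cong) auto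
      also have "\<dots> = (w \<bullet> a)\<^sup>2 * exp (- c * (norm w)\<^sup>2)"
        using a by (simp add: exp_sum[symmetric] norm2 sum_distrib_left sum_negf)
      finally show ?thesis by simp
    qed
    then have "(\<integral>\<^sup>+w. ennreal ((w \<bullet> a)\<^sup>2 * exp (- c * (norm w)\<^sup>2)) \<partial>lborel)
        = (\<integral>\<^sup>+w. (\<Prod>b\<in>Basis. ennreal (F b (w \<bullet> b))) \<partial>lborel)"
      by (simp add: prod_ennreal F_def)
    also have "\<dots> = (\<Prod>b\<in>Basis. \<integral>\<^sup>+x. ennreal (F b x) \<partial>lborel)"
    proof (rule nn_integral_lborel_prod)
      show "(\<lambda>x. ennreal (F b x)) \<in> borel_measurable borel" for b
        unfolding F_def by (cases "b = a") auto
    qed auto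
    also have "\<dots> = (\<Prod>b\<in>Basis. if b = a then p else q)"
      by (intro prod.cong) (auto simp: F_def p_def q_def)
    also have "\<dots> = p * (\<Prod>b\<in>Basis - {a}. if b = a then p else q)"
      using a by (subst prod.remove[of _ a]) auto
    also have "(\<Prod>b\<in>Basis - {a}. if b = a then p else q) = (\<Prod>b\<in>Basis - {a}. q)"
      by (intro prod.cong) auto
    finally show ?thesis using a by simp
  qed
  show ?thesis using *[OF assms(1)] *[OF assms(2)] by (simp add: integral_eq_nn_integral)
qed

lemma norm_sq_cart: "(norm w)\<^sup>2 = (\<Sum>i\<in>UNIV. (w $ i)\<^sup>2)" for w :: "real^'n"
  unfolding power2_norm_eq_inner inner_vec_def by (simp add: power2_eq_square)

lemma gaussian_second_moment:
  fixes c :: real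
  assumes c: "c > 0"
  shows "(\<integral>(w::real^3). (w $ l * w $ m) * exp (- c * (norm w)\<^sup>2) \<partial>lborel)
     = (if l = m then (\<integral>(w::real^3). (norm w)\<^sup>2 * exp (- c * (norm w)\<^sup>2) \<partial>lborel) / 3 else 0)"
proof (cases "l = m")
  case False
  define T where "T w = w - (2 * (w \<bullet> axis l 1)) *\<^sub>R (axis l 1 :: real^3)" for w
  have T: "T w $ i = (if i = l then - (w $ i) else w $ i)" for w i
    unfolding T_def inner_axis by (auto simp: axis_def)
  have "(norm (T w))\<^sup>2 = (norm w)\<^sup>2" for w
    unfolding power2_norm_eq_inner inner_vec_def by (intro sum.cong) (auto simp: T)
  then have "(\<integral>(w::real^3). (w $ l * w $ m) * exp (- c * (norm w)\<^sup>2) \<partial>lborel) = 0"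
    using False by (intro integral_lborel_odd_coordinate[where a = "axis l 1"])
      (auto simp: T_def[symmetric] T axis_in_Basis_iff)
  then show ?thesis using False by simp
next
  case True
  let ?I = "\<lambda>i. \<integral>(w::real^3). (w $ i)\<^sup>2 * exp (- c * (norm w)\<^sup>2) \<partial>lborel"
  have int: "integrable lborel (\<lambda>w::real^3. (w $ i)\<^sup>2 * exp (- c * (norm w)\<^sup>2))" for i
  proof (rule Bochner_Integration.integrable_bound)
    show "integrable lborel (\<lambda>w::real^3. exp (0 + 0 * norm w - c * (norm w)\<^sup>2) * (1 + norm w) ^ 2)"
      by (rule integrable_gaussian_poly[OF c])
    have "(w $ i)\<^sup>2 \<le> (1 + norm w)\<^sup>2" for w :: "real^3"
      using component_le_norm_cart[of w i] by (intro power2_le_iff_abs_le[THEN iffD2]) auto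
    then show "AE w in lborel. norm ((w $ i)\<^sup>2 * exp (- c * (norm w)\<^sup>2))
       \<le> norm (exp (0 + 0 * norm w - c * (norm w)\<^sup>2) * (1 + norm w) ^ 2)"
      by (intro AE_I2) (simp add: mult_right_mono mult.commute)
  qed simp
  have eq: "?I i = ?I l" for i
    using gaussian_second_moment_diagonal[of "axis i (1::real)" "axis l 1" c]
    by (simp add: inner_axis axis_in_Basis_iff)
  have "(\<integral>(w::real^3). (norm w)\<^sup>2 * exp (- c * (norm w)\<^sup>2) \<partial>lborel)
     = (\<integral>(w::real^3). (\<Sum>i\<in>UNIV. (w $ i)\<^sup>2 * exp (- c * (norm w)\<^sup>2)) \<partial>lborel)"
    unfolding sum_distrib_right[symmetric] norm_sq_cart[symmetric] ..
  also have "\<dots> = (\<Sum>i\<in>UNIV. ?I i)" using int by (rule Bochner_Integration.integral_sum)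
  also have "\<dots> = (\<Sum>i\<in>(UNIV::3 set). ?I l)" by (intro sum.cong refl eq)
  also have "\<dots> = 3 * ?I l" by simp
  finally show ?thesis using True by (simp add: power2_eq_square)
qed

section \<open>Flux of a Maxwellian\<close>

text \<open>The coefficients of \<open>ln M[g]\<close> with respect to the collision invariants \<open>1, v, |v|\<^sup>2 / 2\<close>.
  They are stored as a state so that the exponent is the inner product with \<open>phi v\<close>.\<close>

definition log_maxwellian :: "(real^3 \<Rightarrow> real) \<Rightarrow> state" where
  "log_maxwellian g = (ln (density g / (2 * pi * temperature g) powr (3/2)) - (norm (velocity g))\<^sup>2 / (2 * temperature g),
     velocity g /\<^sub>R temperature g, - 1 / temperature g)"

lemma maxwellian_eq_exp:
  assumes "density g > 0" "temperature g > 0"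
  shows "maxwellian g v = exp (log_maxwellian g \<bullet> phi v)"
proof -
  define T x y z \<kappa> where "T = temperature g" and "x = velocity g \<bullet> v" and "y = (norm (velocity g))\<^sup>2"
    and "z = (norm v)\<^sup>2" and "\<kappa> = ln (density g / (2 * pi * temperature g) powr (3/2))"
  note defs = T_def x_def y_def z_def \<kappa>_def
  have T: "T > 0" using assms(2) unfolding T_def .
  have norm: "(norm (velocity g - v))\<^sup>2 = y - 2 * x + z"
    unfolding x_def y_def z_def by (simp add: power2_norm_eq_inner inner_diff_left inner_diff_right inner_commute)
  have "log_maxwellian g \<bullet> phi v = (\<kappa> - y / (2 * T)) + inverse T * x + (- 1 / T) * (z / 2)"
    unfolding defs log_maxwellian_def inner_phi by simp
  also have "\<dots> = \<kappa> + - (y - 2 * x + z) / (2 * T)"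
    using T by (simp add: field_simps)
  finally have "log_maxwellian g \<bullet> phi v = ln (density g / (2 * pi * temperature g) powr (3/2))
      + - (norm (velocity g - v))\<^sup>2 / (2 * temperature g)"
    unfolding norm unfolding T_def \<kappa>_def .
  then have "exp (log_maxwellian g \<bullet> phi v) = exp (ln (density g / (2 * pi * temperature g) powr (3/2)))
      * exp (- (norm (velocity g - v))\<^sup>2 / (2 * temperature g))"
    by (simp only: exp_add)
  then show ?thesis using assms by (simp add: maxwellian_def)
qed

lemma integrable_maxwellian:
  fixes \<psi> :: "real^3 \<Rightarrow> 'b::{banach,second_countable_topology}"
  assumes "density g > 0" "temperature g > 0" "\<psi> \<in> borel_measurable borel"
    and "\<And>v. norm (\<psi> v) \<le> K * (1 + norm v) ^ n"
  shows "integrable lborel (\<lambda>v. maxwellian g v *\<^sub>R \<psi> v)"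
  using assms integrable_exp_inner_phi[of "log_maxwellian g" \<psi> K n]
  by (simp add: maxwellian_eq_exp log_maxwellian_def)

lemma integral_scaleR_phi:
  assumes "integrable lborel (\<lambda>v. k v *\<^sub>R phi v)"
  shows "integrable lborel (\<lambda>v. k v *\<^sub>R v)"
    and "(\<integral>v. k v *\<^sub>R phi v \<partial>lborel) =
      (\<integral>v. k v \<partial>lborel, \<integral>v. k v *\<^sub>R v \<partial>lborel, \<integral>v. k v * ((norm v)\<^sup>2 / 2) \<partial>lborel)"
proof -
  have bl: "bounded_linear (\<lambda>U::state. fst U)" "bounded_linear (\<lambda>U::state. fst (snd U))"
      "bounded_linear (\<lambda>U::state. snd (snd U))"
    by (intro bounded_linear_fst bounded_linear_snd bounded_linear_compose[OF bounded_linear_fst]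
        bounded_linear_compose[OF bounded_linear_snd])+
  show "integrable lborel (\<lambda>v. k v *\<^sub>R v)"
    using integrable_bounded_linear[OF bl(2) assms] by (simp add: phi_def)
  note e = integral_bounded_linear[OF bl(1) assms] integral_bounded_linear[OF bl(2) assms]
    integral_bounded_linear[OF bl(3) assms]
  show "(\<integral>v. k v *\<^sub>R phi v \<partial>lborel) =
      (\<integral>v. k v \<partial>lborel, \<integral>v. k v *\<^sub>R v \<partial>lborel, \<integral>v. k v * ((norm v)\<^sup>2 / 2) \<partial>lborel)"
    using e by (intro prod_eqI) (simp_all add: phi_def)
qed

lemma moments_maxwellian:
  assumes pos: "density g > 0" "temperature g > 0" and g: "maxwellian g = g"
  shows "integral\<^sup>L lborel g = density g"
    and "(\<integral>v. g v *\<^sub>R v \<partial>lborel) = density g *\<^sub>R velocity g"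
    and "(\<integral>v. g v * ((norm v)\<^sup>2 / 2) \<partial>lborel) = snd (snd (moments g))"
proof -
  have int: "integrable lborel (\<lambda>v. g v *\<^sub>R phi v)"
    using integrable_maxwellian[OF pos, of phi 1 2] norm_phi_le by (simp add: g)
  note m = integral_scaleR_phi(2)[OF int]
  show "integral\<^sup>L lborel g = density g"
    unfolding density_def moments_def bracket_def m by simp
  show "(\<integral>v. g v *\<^sub>R v \<partial>lborel) = density g *\<^sub>R velocity g"
    using pos(1) unfolding velocity_def by (simp add: moments_def bracket_def m)
  show "(\<integral>v. g v * ((norm v)\<^sup>2 / 2) \<partial>lborel) = snd (snd (moments g))"
    by (simp add: moments_def bracket_def m)
qed

lemma maxwellian_centered:
  "maxwellian g v = density g / (2 * pi * temperature g) powr (3/2) *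
     exp (- (1 / (2 * temperature g)) * (norm (v - velocity g))\<^sup>2)"
  by (simp add: maxwellian_def norm_minus_commute)

text \<open>By symmetry the centred second moments form a multiple of the identity. The trace gives the
  multiple, since it is \<open>3 \<rho> T\<close> by the definition of the temperature, which is itself an integral
  of the Maxwellian when \<open>M[g] = g\<close>.\<close>

lemma maxwellian_pressure_tensor:
  assumes pos: "density g > 0" "temperature g > 0" and g: "maxwellian g = g"
  shows "(\<integral>v. g v * ((v - velocity g) $ l * (v - velocity g) $ m) \<partial>lborel) =
    (if l = m then density g * temperature g else 0)"
proof -
  define u where "u = velocity g"
  define c where "c = 1 / (2 * temperature g)"
  define K where "K = density g / (2 * pi * temperature g) powr (3/2)"
  have c: "c > 0" using pos by (simp add: c_def)
  have gK: "g v = K * exp (- c * (norm (v - u))\<^sup>2)" for v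
    using maxwellian_centered[of g v] by (simp add: g u_def c_def K_def)
  have "(\<integral>v. g v * (norm (v - u))\<^sup>2 \<partial>lborel) = 3 * density g * temperature g"
    using pos(1) unfolding temperature_def by (simp add: u_def bracket_def mult.commute)
  moreover have "(\<integral>v. g v * (norm (v - u))\<^sup>2 \<partial>lborel) = (\<integral>(v::real^3). K * ((norm v)\<^sup>2 * exp (- c * (norm v)\<^sup>2)) \<partial>lborel)"
  proof -
    have "(\<integral>v. g v * (norm (v - u))\<^sup>2 \<partial>lborel) = (\<integral>v. K * ((norm (v - u))\<^sup>2 * exp (- c * (norm (v - u))\<^sup>2)) \<partial>lborel)"
      unfolding gK by (simp only: mult_ac)
    also have "\<dots> = (\<integral>(v::real^3). K * ((norm v)\<^sup>2 * exp (- c * (norm v)\<^sup>2)) \<partial>lborel)"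
      by (rule integral_lborel_translate[of "\<lambda>v. K * ((norm v)\<^sup>2 * exp (- c * (norm v)\<^sup>2))"]) simp
    finally show ?thesis .
  qed
  ultimately have tr: "K * (\<integral>v. (norm v)\<^sup>2 * exp (- c * (norm v)\<^sup>2) \<partial>(lborel :: (real^3) measure)) = 3 * density g * temperature g"
    by simp
  have "(\<integral>v. g v * ((v - u) $ l * (v - u) $ m) \<partial>lborel) = (\<integral>v. K * ((v $ l * v $ m) * exp (- c * (norm v)\<^sup>2)) \<partial>lborel)"
  proof -
    have "(\<integral>v. g v * ((v - u) $ l * (v - u) $ m) \<partial>lborel)
        = (\<integral>v. K * (((v - u) $ l * (v - u) $ m) * exp (- c * (norm (v - u))\<^sup>2)) \<partial>lborel)"
      unfolding gK by (simp only: mult_ac)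
    also have "\<dots> = (\<integral>v. K * ((v $ l * v $ m) * exp (- c * (norm v)\<^sup>2)) \<partial>lborel)"
      by (rule integral_lborel_translate[of "\<lambda>v. K * ((v $ l * v $ m) * exp (- c * (norm v)\<^sup>2))"]) simp
    finally show ?thesis .
  qed
  also have "\<dots> = K * (if l = m then (\<integral>w. (norm w)\<^sup>2 * exp (- c * (norm w)\<^sup>2) \<partial>(lborel :: (real^3) measure)) / 3 else 0)"
    using gaussian_second_moment[OF c, of l m] by simp
  finally show ?thesis using tr by (simp add: u_def[symmetric])
qed

lemma maxwellian_heat_flux:
  assumes g: "maxwellian g = g"
  shows "(\<integral>v. g v * ((v - velocity g) $ l * (norm (v - velocity g))\<^sup>2) \<partial>lborel) = 0"
proof -
  define u where "u = velocity g"
  define c where "c = 1 / (2 * temperature g)"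
  define K where "K = density g / (2 * pi * temperature g) powr (3/2)"
  have gK: "g v = K * exp (- c * (norm (v - u))\<^sup>2)" for v
    using maxwellian_centered[of g v] by (simp add: g u_def c_def K_def)
  let ?h = "\<lambda>v::real^3. K * exp (- c * (norm v)\<^sup>2) * (v $ l * (norm v)\<^sup>2)"
  have "(\<integral>v. g v * ((v - u) $ l * (norm (v - u))\<^sup>2) \<partial>lborel) = (\<integral>v. ?h (v - u) \<partial>lborel)"
    unfolding gK ..
  also have "\<dots> = integral\<^sup>L lborel ?h" by (rule integral_lborel_translate) simp
  also have "\<dots> = 0" by (rule integral_lborel_odd) simp_all
  finally show ?thesis by (simp add: u_def)
qed

text \<open>Expanding \<open>v = u + (v - u)\<close> reduces the moments up to order three to the pressure tensor, to the
  heat flux, which vanishes, and to the moments of order at most two in \<open>moments g\<close>.\<close>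

lemma integral_flux_maxwellian:
  assumes pos: "density g > 0" "temperature g > 0" and g: "maxwellian g = g"
  shows "(\<integral>v. g v *\<^sub>R (v $ l *\<^sub>R phi v) \<partial>lborel) = euler_flux l (moments g)"
proof -
  define \<rho> u T E where "\<rho> = density g" and "u = velocity g" and "T = temperature g" and "E = snd (snd (moments g))"
  have nsq: "(norm w)\<^sup>2 = (\<Sum>i\<in>UNIV. w $ i * w $ i)" for w :: "real^3"
    unfolding power2_norm_eq_inner inner_vec_def by simp
  have \<rho>: "\<rho> > 0" using pos by (simp add: \<rho>_def)
  have comp: "\<bar>v $ i\<bar> \<le> 1 + norm v" for v :: "real^3" and i
    using component_le_norm_cart[of v i] by simp
  have int: "integrable lborel (\<lambda>v. g v * \<psi> v)" if "\<psi> \<in> borel_measurable borel" "\<And>v. \<bar>\<psi> v\<bar> \<le> K * (1 + norm v) ^ n" for \<psi> :: "real^3 \<Rightarrow> real" and K n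
    using integrable_maxwellian[OF pos, of \<psi> K n] that by (simp add: g)
  have i0: "integrable lborel g" using int[of "\<lambda>_. 1" 1 0] by simp
  have i1: "integrable lborel (\<lambda>v. g v * v $ i)" for i
    using comp by (intro int[of _ 1 1]) auto
  have i2: "integrable lborel (\<lambda>v. g v * (v $ i * v $ j))" for i j
    by (rule int[of _ 1 2]) (auto simp: abs_mult power2_eq_square intro!: mult_mono comp)
  have iE: "integrable lborel (\<lambda>v. g v * ((norm v)\<^sup>2 / 2))"
    by (rule int[of _ 1 2]) (auto simp: power2_eq_square field_simps)
  have i2': "integrable lborel (\<lambda>v. g v * (v $ l * (v \<bullet> a)))" for a
  proof -
    have "g v * (v $ l * (v \<bullet> a)) = (\<Sum>i\<in>UNIV. a $ i * (g v * (v $ l * v $ i)))" for v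
      by (simp add: inner_vec_def sum_distrib_left mult_ac)
    then show ?thesis using i2 by (simp add: integrable_sum)
  qed
  have i3: "integrable lborel (\<lambda>v. g v * (v $ l * ((norm v)\<^sup>2 / 2)))"
  proof (rule int[of _ 1 3])
    fix v :: "real^3"
    have "\<bar>v $ l * ((norm v)\<^sup>2 / 2)\<bar> = \<bar>v $ l\<bar> * ((norm v)\<^sup>2 / 2)" by (simp add: abs_mult)
    also have "\<dots> \<le> (1 + norm v) * (1 + norm v)\<^sup>2"
      by (intro mult_mono comp) (auto simp: power2_eq_square field_simps)
    finally show "\<bar>v $ l * ((norm v)\<^sup>2 / 2)\<bar> \<le> 1 * (1 + norm v) ^ 3" by (simp add: power3_eq_cube power2_eq_square mult.assoc)
  qed simp
  have intphi: "integrable lborel (\<lambda>v. (g v * v $ l) *\<^sub>R phi v)"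
  proof -
    have "norm (v $ l *\<^sub>R phi v) \<le> 1 * (1 + norm v) ^ 3" for v
    proof -
      have "\<bar>v $ l\<bar> * norm (phi v) \<le> (1 + norm v) * (1 + norm v)\<^sup>2"
        by (intro mult_mono comp norm_phi_le) auto
      then show ?thesis by (simp add: power3_eq_cube power2_eq_square mult.assoc)
    qed
    from integrable_maxwellian[OF pos _ this] show ?thesis by (simp add: g)
  qed
  have m: "moments g = (\<rho>, \<rho> *\<^sub>R u, E)"
    using pos(1) by (intro prod_eqI) (simp_all add: \<rho>_def u_def E_def density_def velocity_def)
  note M = moments_maxwellian[OF pos g, folded \<rho>_def u_def T_def E_def]
  have M1: "(\<integral>v. g v * v $ i \<partial>lborel) = \<rho> * u $ i" for i
  proof -
    have "integrable lborel (\<lambda>v. g v *\<^sub>R v)"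
      using integrable_maxwellian[OF pos, of "\<lambda>v. v" 1 1] by (simp add: g)
    from integral_bounded_linear[OF bounded_linear_vec_nth this, of i] M(2) show ?thesis by simp
  qed
  note P = maxwellian_pressure_tensor[OF pos g, folded \<rho>_def u_def T_def]
  have M2: "(\<integral>v. g v * (v $ k * v $ i) \<partial>lborel) = \<rho> * u $ k * u $ i + (if k = i then \<rho> * T else 0)" for k i
  proof -
    have "g v * (v $ k * v $ i) = g v * ((v - u) $ k * (v - u) $ i) + u $ k * (g v * v $ i) + u $ i * (g v * v $ k) - u $ k * u $ i * g v" for v
      by (simp add: algebra_simps)
    moreover have "integrable lborel (\<lambda>v. g v * ((v - u) $ k * (v - u) $ i))"
    proof -
      have "g v * ((v - u) $ k * (v - u) $ i) = g v * (v $ k * v $ i) - u $ k * (g v * v $ i) - u $ i * (g v * v $ k) + u $ k * u $ i * g v" for v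
        by (simp add: algebra_simps)
      then show ?thesis using i0 i1 i2 by simp
    qed
    ultimately show ?thesis using i0 i1 by (simp add: P[unfolded vector_minus_component] M1 M(1))
  qed
  \<comment> \<open>The trace of the second moments relates the temperature to the energy as in the Euler flux.\<close>
  have T: "T = (2 * E / \<rho> - (norm u)\<^sup>2) / 3"
  proof -
    have "(\<integral>v. g v * (norm v)\<^sup>2 \<partial>lborel) = 2 * E"
      using M(3) by simp
    moreover have "(\<integral>v. g v * (norm v)\<^sup>2 \<partial>lborel) = (\<integral>v. (\<Sum>i\<in>UNIV. g v * (v $ i * v $ i)) \<partial>lborel)"
      by (simp add: nsq sum_distrib_left)
    moreover have "\<dots> = (\<Sum>i\<in>UNIV. (\<integral>v. g v * (v $ i * v $ i) \<partial>lborel))"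
      by (rule Bochner_Integration.integral_sum) (rule i2)
    moreover have "\<And>i. (\<integral>v. g v * (v $ i * v $ i) \<partial>lborel) = \<rho> * u $ i * u $ i + \<rho> * T"
      by (simp add: M2)
    ultimately have "2 * E = \<rho> * (norm u)\<^sup>2 + 3 * \<rho> * T"
      by (simp add: sum.distrib nsq sum_distrib_left mult.assoc)
    then show ?thesis using \<rho> by (simp add: field_simps)
  qed
  have M3: "(\<integral>v. g v * (v $ l * ((norm v)\<^sup>2 / 2)) \<partial>lborel) = E * u $ l + \<rho> * T * u $ l"
  proof -
    \<comment> \<open>Integrating this expansion and using that the heat flux vanishes determines the third moment.\<close>
    have eq: "g v * ((v - u) $ l * (norm (v - u))\<^sup>2) =
        2 * (g v * (v $ l * ((norm v)\<^sup>2 / 2))) - 2 * (g v * (v $ l * (v \<bullet> u))) + (norm u)\<^sup>2 * (g v * v $ l)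
         - 2 * u $ l * (g v * ((norm v)\<^sup>2 / 2)) + 2 * u $ l * (\<Sum>i\<in>UNIV. u $ i * (g v * v $ i)) - u $ l * (norm u)\<^sup>2 * g v" for v
    proof -
      have norm: "(norm (v - u))\<^sup>2 = (norm v)\<^sup>2 - 2 * (v \<bullet> u) + (norm u)\<^sup>2"
        by (simp add: power2_norm_eq_inner inner_diff_left inner_diff_right inner_commute)
      have sum: "(\<Sum>i\<in>UNIV. u $ i * (g v * v $ i)) = g v * (v \<bullet> u)"
        by (simp add: inner_vec_def sum_distrib_left mult_ac)
      show ?thesis unfolding norm sum by (simp add: algebra_simps)
    qed
    have "(\<integral>v. g v * (v $ l * (v \<bullet> u)) \<partial>lborel) = (\<integral>v. (\<Sum>i\<in>UNIV. u $ i * (g v * (v $ l * v $ i))) \<partial>lborel)"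
      by (simp add: inner_vec_def sum_distrib_left mult_ac)
    also have "\<dots> = (\<Sum>i\<in>UNIV. u $ i * (\<rho> * u $ l * u $ i + (if l = i then \<rho> * T else 0)))"
      using i2 by (simp add: M2)
    also have "\<dots> = (\<Sum>i\<in>UNIV. \<rho> * u $ l * (u $ i * u $ i) + (if l = i then u $ l * (\<rho> * T) else 0))"
      by (intro sum.cong) (auto simp: algebra_simps)
    also have "\<dots> = \<rho> * u $ l * (norm u)\<^sup>2 + u $ l * (\<rho> * T)"
      by (simp add: sum.distrib sum_distrib_left[symmetric] nsq)
    finally have 2: "(\<integral>v. g v * (v $ l * (v \<bullet> u)) \<partial>lborel) = \<rho> * u $ l * (norm u)\<^sup>2 + u $ l * (\<rho> * T)" .
    have 1: "(\<integral>v. (\<Sum>i\<in>UNIV. u $ i * (g v * v $ i)) \<partial>lborel) = \<rho> * (norm u)\<^sup>2"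
    proof -
      have "(\<integral>v. (\<Sum>i\<in>UNIV. u $ i * (g v * v $ i)) \<partial>lborel) = (\<Sum>i\<in>UNIV. u $ i * (\<rho> * u $ i))"
        using i1 by (simp add: M1)
      then show ?thesis by (simp add: nsq sum_distrib_left mult.left_commute)
    qed
    have isum: "integrable lborel (\<lambda>v. \<Sum>i\<in>UNIV. u $ i * (g v * v $ i))" using i1 by simp
    have "0 = (\<integral>v. g v * ((v - u) $ l * (norm (v - u))\<^sup>2) \<partial>lborel)"
      using maxwellian_heat_flux[OF g, of l] by (simp add: u_def)
    also have "\<dots> = 2 * (\<integral>v. g v * (v $ l * ((norm v)\<^sup>2 / 2)) \<partial>lborel) - 2 * (\<integral>v. g v * (v $ l * (v \<bullet> u)) \<partial>lborel)
        + (norm u)\<^sup>2 * (\<integral>v. g v * v $ l \<partial>lborel) - 2 * u $ l * (\<integral>v. g v * ((norm v)\<^sup>2 / 2) \<partial>lborel)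
        + 2 * u $ l * (\<integral>v. (\<Sum>i\<in>UNIV. u $ i * (g v * v $ i)) \<partial>lborel) - u $ l * (norm u)\<^sup>2 * integral\<^sup>L lborel g"
      unfolding eq using i0 i1 i2'[of u] i3 iE isum
      by (simp only: Bochner_Integration.integral_add Bochner_Integration.integral_diff
         Bochner_Integration.integrable_add Bochner_Integration.integrable_diff integrable_mult_right integral_mult_right_zero)
    also have "\<dots> = 2 * (\<integral>v. g v * (v $ l * ((norm v)\<^sup>2 / 2)) \<partial>lborel) - 2 * (\<rho> * u $ l * (norm u)\<^sup>2 + u $ l * (\<rho> * T))
        + (norm u)\<^sup>2 * (\<rho> * u $ l) - 2 * u $ l * E + 2 * u $ l * (\<rho> * (norm u)\<^sup>2) - u $ l * (norm u)\<^sup>2 * \<rho>"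
      unfolding 1 2 M1 M by simp
    finally show ?thesis by (simp add: algebra_simps)
  qed
  have "(\<integral>v. g v *\<^sub>R (v $ l *\<^sub>R phi v) \<partial>lborel) =
      (\<integral>v. g v * v $ l \<partial>lborel, \<integral>v. (g v * v $ l) *\<^sub>R v \<partial>lborel, \<integral>v. (g v * v $ l) * ((norm v)\<^sup>2 / 2) \<partial>lborel)"
    using integral_scaleR_phi(2)[OF intphi] by simp
  also have "\<dots> = (\<rho> * u $ l, (\<rho> * u $ l) *\<^sub>R u + (\<rho> * T) *\<^sub>R axis l 1, E * u $ l + \<rho> * T * u $ l)"
  proof (intro arg_cong2[where f = Pair])
    show "(\<integral>v. (g v * v $ l) *\<^sub>R v \<partial>lborel) = (\<rho> * u $ l) *\<^sub>R u + (\<rho> * T) *\<^sub>R axis l 1"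
      unfolding vec_eq_iff
    proof
      fix i
      have "(\<integral>v. (g v * v $ l) *\<^sub>R v \<partial>lborel) $ i = (\<integral>v. ((g v * v $ l) *\<^sub>R v) $ i \<partial>lborel)"
        using integral_bounded_linear[OF bounded_linear_vec_nth integral_scaleR_phi(1)[OF intphi], of i] by simp
      then show "(\<integral>v. (g v * v $ l) *\<^sub>R v \<partial>lborel) $ i = ((\<rho> * u $ l) *\<^sub>R u + (\<rho> * T) *\<^sub>R axis l 1) $ i"
        using M2[of l i] by (auto simp: axis_def mult.assoc)
    qed
  qed (use M1 M3 in \<open>simp_all add: mult.assoc\<close>)
  also have "\<dots> = euler_flux l (moments g)"
  proof -
    have "(\<rho> *\<^sub>R u) /\<^sub>R \<rho> = u" using \<rho> by simp
    then show ?thesis unfolding m euler_flux_def Let_def by (simp only: prod.case T[symmetric])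
  qed
  finally show ?thesis .
qed

section \<open>Moments of the transport term of a local Maxwellian\<close>

text \<open>On \<open>\<Omega>\<close> the function \<open>ln f\<close> is linear in the collision invariants, so the differentiability of
  \<open>f\<close> in \<open>x\<close> for each \<open>v\<close> passes to the coefficients, and the derivative of the flux integral can be
  taken under the integral. Openness of \<open>\<Omega>\<close> ensures that \<open>f\<close> is Maxwellian along a whole segment
  through \<open>x\<close>.\<close>

lemma
  fixes f :: "'d::finite phase"
  assumes \<Omega>: "open \<Omega>" and adm: "admissible_class \<Omega> \<iota> \<D>" and f: "f \<in> \<D>"
    and eq: "\<And>x v. x \<in> \<Omega> \<Longrightarrow> f x v = maxwellian (f x) v" and x: "x \<in> \<Omega>"
  shows integrable_flux_derivative: "integrable lborel (\<lambda>v. (v $ l * partial_deriv k (\<lambda>y. f y v) x) *\<^sub>R phi v)"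
    and flux_has_derivative: "((\<lambda>s. euler_flux l (moments (f (x + s *\<^sub>R axis k 1)))) has_vector_derivative
      (\<integral>v. (v $ l * partial_deriv k (\<lambda>y. f y v) x) *\<^sub>R phi v \<partial>lborel)) (at 0)"
proof -
  define S where "S = (\<lambda>s. x + s *\<^sub>R axis k (1::real)) -` \<Omega>"
  define \<theta> where "\<theta> s = log_maxwellian (f (x + s *\<^sub>R axis k 1))" for s
  have S: "open S" "0 \<in> S"
    using \<Omega> x unfolding S_def by (auto intro!: open_vimage continuous_intros)
  have pos: "density (f y) > 0" "temperature (f y) > 0" if "y \<in> \<Omega>" for y
    using adm f that by (auto simp: admissible_class_def)
  have fexp: "f (x + s *\<^sub>R axis k 1) v = exp (\<theta> s \<bullet> phi v)" if "s \<in> S" for s v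
    using eq[of "x + s *\<^sub>R axis k 1" v] maxwellian_eq_exp[OF pos, of "x + s *\<^sub>R axis k 1" v] that
    by (simp add: S_def \<theta>_def)
  have "(\<lambda>s. \<theta> s \<bullet> phi v) differentiable (at 0)" for v
  proof -
    have "(\<lambda>s. f (x + s *\<^sub>R axis k 1) v) differentiable (at 0)"
      using adm f x by (auto simp: admissible_class_def partially_differentiable_def)
    then obtain d where "((\<lambda>s. f (x + s *\<^sub>R axis k 1) v) has_real_derivative d) (at 0)"
      by (auto simp: real_differentiable_def)
    moreover have "f (x + 0 *\<^sub>R axis k 1) v > 0" using fexp[OF S(2)] by simp
    ultimately have "((\<lambda>s. ln (f (x + s *\<^sub>R axis k 1) v)) has_real_derivative
        inverse (f (x + 0 *\<^sub>R axis k 1) v) * d) (at 0)"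
      by (intro DERIV_chain2[where f = ln] DERIV_ln)
    then have "((\<lambda>s. \<theta> s \<bullet> phi v) has_real_derivative inverse (f (x + 0 *\<^sub>R axis k 1) v) * d) (at 0)"
      by (rule has_field_derivative_transform_within_open[OF _ S]) (simp add: fexp)
    then show ?thesis by (auto simp: real_differentiable_def)
  qed
  then have "\<theta> differentiable (at 0)" by (rule differentiable_of_inner_phi)
  then obtain \<theta>' where \<theta>': "(\<theta> has_vector_derivative \<theta>') (at 0)"
    by (auto simp: vector_derivative_works)
  have neg: "snd (snd (\<theta> 0)) < 0"
    using pos[OF x] by (simp add: \<theta>_def log_maxwellian_def)
  have pd: "partial_deriv k (\<lambda>y. f y v) x = (\<theta>' \<bullet> phi v) * exp (\<theta> 0 \<bullet> phi v)" for v
  proof -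
    have "((\<lambda>s. \<theta> s \<bullet> phi v) has_real_derivative \<theta>' \<bullet> phi v) (at 0)"
      unfolding has_real_derivative_iff_has_vector_derivative
      by (rule bounded_linear.has_vector_derivative[OF bounded_linear_inner_left \<theta>'])
    then have "((\<lambda>s. exp (\<theta> s \<bullet> phi v)) has_real_derivative exp (\<theta> 0 \<bullet> phi v) * (\<theta>' \<bullet> phi v)) (at 0)"
      by (rule DERIV_fun_exp)
    then have "((\<lambda>s. f (x + s *\<^sub>R axis k 1) v) has_real_derivative exp (\<theta> 0 \<bullet> phi v) * (\<theta>' \<bullet> phi v)) (at 0)"
      by (rule has_field_derivative_transform_within_open[OF _ S]) (simp add: fexp)
    then show ?thesis
      unfolding partial_deriv_def has_real_derivative_iff_has_vector_derivative
      by (simp add: vector_derivative_at mult.commute)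
  qed
  have \<psi>: "norm (v $ l *\<^sub>R phi v) \<le> 1 * (1 + norm v) ^ 3" for v
  proof -
    have "\<bar>v $ l\<bar> * norm (phi v) \<le> (1 + norm v) * (1 + norm v)\<^sup>2"
      using component_le_norm_cart[of v l] by (intro mult_mono norm_phi_le) auto
    then show ?thesis by (simp add: power3_eq_cube power2_eq_square mult.assoc)
  qed
  have "norm ((\<theta>' \<bullet> phi v) *\<^sub>R (v $ l *\<^sub>R phi v)) \<le> norm \<theta>' * (1 + norm v) ^ 5" for v
  proof -
    have "norm ((\<theta>' \<bullet> phi v) *\<^sub>R (v $ l *\<^sub>R phi v)) \<le> (norm \<theta>' * norm (phi v)) * norm (v $ l *\<^sub>R phi v)"
      unfolding norm_scaleR[of "\<theta>' \<bullet> phi v"] by (intro mult_right_mono Cauchy_Schwarz_ineq2) auto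
    also have "\<dots> \<le> (norm \<theta>' * (1 + norm v)\<^sup>2) * (1 * (1 + norm v) ^ 3)"
      by (intro mult_mono \<psi> norm_phi_le mult_left_mono) auto
    finally show ?thesis by (simp add: mult.assoc flip: power_add)
  qed
  from integrable_exp_inner_phi[OF neg _ this]
  show "integrable lborel (\<lambda>v. (v $ l * partial_deriv k (\<lambda>y. f y v) x) *\<^sub>R phi v)"
    by (simp add: pd mult_ac)
  have "((\<lambda>s. \<integral>v. exp (\<theta> s \<bullet> phi v) *\<^sub>R (v $ l *\<^sub>R phi v) \<partial>lborel) has_vector_derivative
     (\<integral>v. ((\<theta>' \<bullet> phi v) * exp (\<theta> 0 \<bullet> phi v)) *\<^sub>R (v $ l *\<^sub>R phi v) \<partial>lborel)) (at 0)"
    by (rule has_vector_derivative_integral_exp_inner_phi[OF \<theta>' neg _ \<psi>]) simp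
  then have "((\<lambda>s. euler_flux l (moments (f (x + s *\<^sub>R axis k 1)))) has_vector_derivative
     (\<integral>v. ((\<theta>' \<bullet> phi v) * exp (\<theta> 0 \<bullet> phi v)) *\<^sub>R (v $ l *\<^sub>R phi v) \<partial>lborel)) (at 0)"
  proof (rule has_vector_derivative_transform_within_open[OF _ S])
    fix s assume s: "s \<in> S"
    then have y: "x + s *\<^sub>R axis k 1 \<in> \<Omega>" by (simp add: S_def)
    have "maxwellian (f (x + s *\<^sub>R axis k 1)) = f (x + s *\<^sub>R axis k 1)"
      using eq[OF y] by (simp add: fun_eq_iff)
    from integral_flux_maxwellian[OF pos[OF y] this, of l]
    show "(\<integral>v. exp (\<theta> s \<bullet> phi v) *\<^sub>R (v $ l *\<^sub>R phi v) \<partial>lborel) = euler_flux l (moments (f (x + s *\<^sub>R axis k 1)))"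
      by (simp add: fexp[OF s])
  qed
  then show "((\<lambda>s. euler_flux l (moments (f (x + s *\<^sub>R axis k 1)))) has_vector_derivative
      (\<integral>v. (v $ l * partial_deriv k (\<lambda>y. f y v) x) *\<^sub>R phi v \<partial>lborel)) (at 0)"
    by (simp add: pd mult_ac)
qed

lemma
  fixes f :: "'d::finite phase"
  assumes "open \<Omega>" and "admissible_class \<Omega> \<iota> \<D>" and "f \<in> \<D>"
    and "\<And>x v. x \<in> \<Omega> \<Longrightarrow> f x v = maxwellian (f x) v" and "x \<in> \<Omega>"
  shows partially_differentiable_flux: "partially_differentiable k (\<lambda>y. euler_flux l (moments (f y))) x"
    and moments_transport_maxwellian: "moments (transport \<iota> f x) = - div_euler_flux \<iota> (\<lambda>y. moments (f y)) x"
proof -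
  note d = flux_has_derivative[OF assms] and i = integrable_flux_derivative[OF assms]
  show "partially_differentiable k (\<lambda>y. euler_flux l (moments (f y))) x"
    using d unfolding partially_differentiable_def by (rule differentiableI_vector)
  have pd: "partial_deriv k (\<lambda>y. euler_flux l (moments (f y))) x
      = (\<integral>v. (v $ l * partial_deriv k (\<lambda>y. f y v) x) *\<^sub>R phi v \<partial>lborel)" for k l
    unfolding partial_deriv_def[of _ "\<lambda>y. euler_flux _ (moments (f y))"] by (rule vector_derivative_at[OF d])
  have "moments (transport \<iota> f x) = (\<integral>v. - (\<Sum>k\<in>UNIV. (v $ \<iota> k * partial_deriv k (\<lambda>y. f y v) x) *\<^sub>R phi v) \<partial>lborel)"
    unfolding moments_def bracket_def transport_def scaleR_minus_left scaleR_sum_left ..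
  also have "\<dots> = - (\<Sum>k\<in>UNIV. \<integral>v. (v $ \<iota> k * partial_deriv k (\<lambda>y. f y v) x) *\<^sub>R phi v \<partial>lborel)"
    unfolding integral_minus using i by (simp only: Bochner_Integration.integral_sum)
  also have "\<dots> = - div_euler_flux \<iota> (\<lambda>y. moments (f y)) x"
    unfolding div_euler_flux_def pd ..
  finally show "moments (transport \<iota> f x) = - div_euler_flux \<iota> (\<lambda>y. moments (f y)) x" .
qed

section \<open>Tableaux of type CK\<close>

lemma type_CK_nonempty:
  assumes "imex_tableau \<nu> At wt A w" "type_CK \<nu> A"
  shows "\<nu> > 0"
  using assms by (auto simp: imex_tableau_def type_CK_def)

lemma type_CK_first_row:
  assumes "imex_tableau \<nu> At wt A w" "type_CK \<nu> A" "j < \<nu>"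
  shows "A $$ (0, j) = 0"
  using assms by (auto simp: imex_tableau_def type_CK_def)

text \<open>The invertible block is lower triangular, hence its determinant is the product of its
  diagonal entries.\<close>

lemma type_CK_diagonal_nonzero:
  assumes tab: "imex_tableau \<nu> At wt A w" and CK: "type_CK \<nu> A" and i: "0 < i" "i < \<nu>"
  shows "A $$ (i, i) \<noteq> 0"
proof -
  define m where "m = \<nu> - 1"
  have \<nu>: "\<nu> = Suc m" using i by (simp add: m_def)
  obtain a H where a: "a \<in> carrier_mat m 1" and H: "H \<in> carrier_mat m m" and inv: "invertible_mat H"
    and A: "A = four_block_mat (0\<^sub>m 1 1) (0\<^sub>m 1 m) a H"
    using CK by (auto simp: type_CK_def m_def)
  have H_eq: "H $$ (p, q) = A $$ (Suc p, Suc q)" if "p < m" "q < m" for p q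
    using that a H unfolding A by simp
  obtain B where B: "inverts_mat H B" "inverts_mat B H" using inv by (auto simp: invertible_mat_def)
  have B': "B \<in> carrier_mat m m"
    using B H by (metis carrier_matD carrier_matI index_mult_mat(3) index_one_mat(3) inverts_mat_def)
  have "Determinant.det H * Determinant.det B = 1"
    using B(1) H B' by (simp add: inverts_mat_def flip: det_mult)
  moreover have "Determinant.det H = prod_list (diag_mat H)"
    using tab by (intro det_lower_triangular[OF _ H]) (auto simp: H_eq imex_tableau_def \<nu>)
  ultimately have "0 \<notin> set (diag_mat H)" by (metis mult_zero_left prod_list_zero_iff zero_neq_one)
  moreover have "A $$ (i, i) \<in> set (diag_mat H)"
    using i H H_eq[of "i - 1" "i - 1"] by (auto simp: diag_mat_def \<nu> intro!: image_eqI[of _ _ "i - 1"])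
  ultimately show ?thesis by force
qed

section \<open>The limit of the scheme\<close>

lemma limits_agree_at_right:
  fixes g h :: "real \<Rightarrow> 'a::t2_space"
  assumes "\<And>\<epsilon>. \<epsilon> > 0 \<Longrightarrow> g \<epsilon> = h \<epsilon>" "(g \<longlongrightarrow> a) (at_right 0)" "(h \<longlongrightarrow> b) (at_right 0)"
  shows "a = b"
proof -
  have "\<forall>\<^sub>F \<epsilon> in at_right 0. g \<epsilon> = h \<epsilon>"
    using assms(1) by (intro eventually_at_rightI[of 0 1]) auto
  then have "(h \<longlongrightarrow> a) (at_right 0)" by (rule Lim_transform_eventually[OF assms(2)])
  then show ?thesis using assms(3) by (intro tendsto_unique[OF trivial_limit_at_right_real])
qed

text \<open>Multiplication by \<open>\<epsilon>\<close> removes everything but the stiff terms in the limit.\<close>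

lemma stiff_limit_balance:
  fixes G T Q :: "nat \<Rightarrow> real \<Rightarrow> real"
  assumes step: "\<And>\<epsilon>. \<epsilon> > 0 \<Longrightarrow> h \<epsilon> = f \<epsilon> + \<Delta>t * (\<Sum>j<\<nu>. a j * (1 / \<epsilon> * G j \<epsilon> + T j \<epsilon>)) + \<Delta>t / \<epsilon> * (\<Sum>j<\<nu>. b j * Q j \<epsilon>)"
    and h: "(h \<longlongrightarrow> h\<^sub>0) (at_right 0)" and f: "(f \<longlongrightarrow> f\<^sub>0) (at_right 0)"
    and G: "\<And>j. j < \<nu> \<Longrightarrow> (G j \<longlongrightarrow> G\<^sub>0 j) (at_right 0)"
    and T: "\<And>j. j < \<nu> \<Longrightarrow> (T j \<longlongrightarrow> T\<^sub>0 j) (at_right 0)"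
    and Q: "\<And>j. j < \<nu> \<Longrightarrow> (Q j \<longlongrightarrow> Q\<^sub>0 j) (at_right 0)"
    and "\<Delta>t \<noteq> 0"
  shows "(\<Sum>j<\<nu>. a j * G\<^sub>0 j) + (\<Sum>j<\<nu>. b j * Q\<^sub>0 j) = 0"
proof -
  have id: "((\<lambda>\<epsilon>::real. \<epsilon>) \<longlongrightarrow> 0) (at_right 0)" by (rule tendsto_ident_at)
  have lhs: "((\<lambda>\<epsilon>. \<epsilon> * (h \<epsilon> - f \<epsilon> - \<Delta>t * (\<Sum>j<\<nu>. a j * T j \<epsilon>))) \<longlongrightarrow> 0 * (h\<^sub>0 - f\<^sub>0 - \<Delta>t * (\<Sum>j<\<nu>. a j * T\<^sub>0 j))) (at_right 0)"
    by (intro tendsto_mult tendsto_diff tendsto_sum tendsto_const id h f T) auto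
  have rhs: "((\<lambda>\<epsilon>. \<Delta>t * ((\<Sum>j<\<nu>. a j * G j \<epsilon>) + (\<Sum>j<\<nu>. b j * Q j \<epsilon>)))
      \<longlongrightarrow> \<Delta>t * ((\<Sum>j<\<nu>. a j * G\<^sub>0 j) + (\<Sum>j<\<nu>. b j * Q\<^sub>0 j))) (at_right 0)"
    by (intro tendsto_mult tendsto_add tendsto_sum tendsto_const G Q) auto
  have eq: "\<epsilon> * (h \<epsilon> - f \<epsilon> - \<Delta>t * (\<Sum>j<\<nu>. a j * T j \<epsilon>))
      = \<Delta>t * ((\<Sum>j<\<nu>. a j * G j \<epsilon>) + (\<Sum>j<\<nu>. b j * Q j \<epsilon>))" if \<epsilon>: "\<epsilon> > 0" for \<epsilon>
  proof -
    have "(\<Sum>j<\<nu>. a j * (1 / \<epsilon> * G j \<epsilon> + T j \<epsilon>)) = (\<Sum>j<\<nu>. a j * G j \<epsilon>) / \<epsilon> + (\<Sum>j<\<nu>. a j * T j \<epsilon>)"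
      by (simp add: distrib_left sum.distrib sum_divide_distrib)
    then show ?thesis
      using \<epsilon> unfolding step[OF \<epsilon>] by (simp add: field_simps)
  qed
  have "0 * (h\<^sub>0 - f\<^sub>0 - \<Delta>t * (\<Sum>j<\<nu>. a j * T\<^sub>0 j))
      = \<Delta>t * ((\<Sum>j<\<nu>. a j * G\<^sub>0 j) + (\<Sum>j<\<nu>. b j * Q\<^sub>0 j))"
    using eq lhs rhs by (rule limits_agree_at_right)
  then show ?thesis using \<open>\<Delta>t \<noteq> 0\<close> by simp
qed

text \<open>The stiff terms have zero moments for every \<open>\<epsilon>\<close>, so they leave the moment equations before
  the limit is taken, no matter how they behave as \<open>\<epsilon> \<rightarrow> 0\<close>.\<close>

lemma moments_penalized_combination:
  fixes G T Q :: "nat \<Rightarrow> real^3 \<Rightarrow> real"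
  assumes h: "\<And>v. h v = f v + \<Delta>t * (\<Sum>j<\<nu>. a j * (1 / \<epsilon> * G j v + T j v)) + \<Delta>t / \<epsilon> * (\<Sum>j<\<nu>. b j * Q j v)"
    and f: "integrable lborel (\<lambda>v. f v *\<^sub>R phi v)"
    and T: "\<And>j. j < \<nu> \<Longrightarrow> integrable lborel (\<lambda>v. T j v *\<^sub>R phi v)"
    and G: "\<And>j. j < \<nu> \<Longrightarrow> has_bochner_integral lborel (\<lambda>v. G j v *\<^sub>R phi v) 0"
    and Q: "\<And>j. j < \<nu> \<Longrightarrow> has_bochner_integral lborel (\<lambda>v. Q j v *\<^sub>R phi v) 0"
  shows "moments h = moments f + \<Delta>t *\<^sub>R (\<Sum>j<\<nu>. a j *\<^sub>R moments (T j))"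
proof -
  have "has_bochner_integral lborel (\<lambda>v. f v *\<^sub>R phi v
      + \<Delta>t *\<^sub>R (\<Sum>j<\<nu>. a j *\<^sub>R ((1 / \<epsilon>) *\<^sub>R (G j v *\<^sub>R phi v) + T j v *\<^sub>R phi v))
      + (\<Delta>t / \<epsilon>) *\<^sub>R (\<Sum>j<\<nu>. b j *\<^sub>R (Q j v *\<^sub>R phi v)))
    (moments f + \<Delta>t *\<^sub>R (\<Sum>j<\<nu>. a j *\<^sub>R ((1 / \<epsilon>) *\<^sub>R 0 + moments (T j))) + (\<Delta>t / \<epsilon>) *\<^sub>R (\<Sum>j<\<nu>. b j *\<^sub>R 0))"
    unfolding moments_def bracket_def
    by (intro has_bochner_integral_add has_bochner_integral_scaleR_right has_bochner_integral_sum
         has_bochner_integral_integrable f T G Q) auto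
  moreover have "h v *\<^sub>R phi v = f v *\<^sub>R phi v
      + \<Delta>t *\<^sub>R (\<Sum>j<\<nu>. a j *\<^sub>R ((1 / \<epsilon>) *\<^sub>R (G j v *\<^sub>R phi v) + T j v *\<^sub>R phi v))
      + (\<Delta>t / \<epsilon>) *\<^sub>R (\<Sum>j<\<nu>. b j *\<^sub>R (Q j v *\<^sub>R phi v))" for v
    unfolding h by (simp add: scaleR_add_left scaleR_add_right scaleR_sum_left scaleR_sum_right sum.distrib sum_distrib_left mult_ac distrib_left)
  ultimately have "has_bochner_integral lborel (\<lambda>v. h v *\<^sub>R phi v) (moments f + \<Delta>t *\<^sub>R (\<Sum>j<\<nu>. a j *\<^sub>R moments (T j)))"
    by simp
  then show ?thesis unfolding moments_def[of h] bracket_def by (rule has_bochner_integral_integral_eq)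
qed

theorem theorem4p3:
  fixes \<Omega> :: "(real^'d::finite) set" and \<iota> :: "'d \<Rightarrow> 3"
    and B :: "real^3 \<Rightarrow> real^3 \<Rightarrow> real" and QP :: "'d phase \<Rightarrow> 'd phase" and \<D> :: "'d phase set"
    and \<nu> :: nat and At A :: "real mat" and wt w :: "real Matrix.vec" and \<Delta>t :: real
    and f\<^sub>0 :: "real \<Rightarrow> 'd phase"
    and f :: "real \<Rightarrow> nat \<Rightarrow> 'd phase" and F :: "real \<Rightarrow> nat \<Rightarrow> nat \<Rightarrow> 'd phase"
    and flim :: "nat \<Rightarrow> 'd phase" and Flim :: "nat \<Rightarrow> nat \<Rightarrow> 'd phase"
  assumes "open \<Omega>" and "inj \<iota>"
    and "\<And>g n. norm n = 1 \<Longrightarrow> B g n \<ge> 0"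
    and "admissible_class \<Omega> \<iota> \<D>"
    and "collision_like \<Omega> \<D> (Q_B B)" and "collision_like \<Omega> \<D> QP"
    and "imex_tableau \<nu> At wt A w" and "type_CK \<nu> A"
    and "globally_stiffly_accurate \<nu> At wt A w"
    and "\<Delta>t > 0"
    and "\<And>\<epsilon> n. \<epsilon> > 0 \<Longrightarrow> f \<epsilon> n \<in> \<D>"
    and "\<And>\<epsilon> n i. \<epsilon> > 0 \<Longrightarrow> i < \<nu> \<Longrightarrow> F \<epsilon> n i \<in> \<D>"
    and "consistent_initial_data \<Omega> f\<^sub>0"
    and "\<And>\<epsilon>. \<epsilon> > 0 \<Longrightarrow> f \<epsilon> 0 = f\<^sub>0 \<epsilon>"
    and "\<And>\<epsilon> n. \<epsilon> > 0 \<Longrightarrow>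
           penalized_imex_step \<Omega> \<iota> B QP \<nu> At wt A w \<Delta>t \<epsilon> (f \<epsilon> n) (F \<epsilon> n) (f \<epsilon> (Suc n))"
    and "\<And>n. flim n \<in> \<D>" and "\<And>n i. i < \<nu> \<Longrightarrow> Flim n i \<in> \<D>"
    and "\<And>n. formal_limit \<Omega> \<iota> B QP (\<lambda>\<epsilon>. f \<epsilon> n) (flim n)"
    and "\<And>n i. i < \<nu> \<Longrightarrow> formal_limit \<Omega> \<iota> B QP (\<lambda>\<epsilon>. F \<epsilon> n i) (Flim n i)"
  shows "\<forall>n.
    (\<forall>i<\<nu>. \<forall>x\<in>\<Omega>. \<forall>v. Flim n i x v = maxwellian (Flim n i x) v) \<and>
    explicit_RK_euler_step \<Omega> \<iota> \<nu> At wt \<Delta>t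
      (\<lambda>x. moments (flim n x)) (\<lambda>i x. moments (Flim n i x)) (\<lambda>x. moments (flim (Suc n) x))"
proof
  fix n
  note \<Omega> = assms(1) and adm = assms(4) and QB = assms(5) and QP = assms(6) and tab = assms(7) and CK = assms(8)
    and GSA = assms(9) and dt = assms(10) and fD = assms(11) and FD = assms(12) and init = assms(13) and f0 = assms(14)
    and step = assms(15) and flimD = assms(16) and FlimD = assms(17) and flim = assms(18) and Flim = assms(19)
  have \<nu>: "0 < \<nu>" by (rule type_CK_nonempty[OF tab CK])
  have At0: "At $$ (i, j) = 0" if "i \<le> j" "j < \<nu>" for i j
    using tab that by (auto simp: imex_tableau_def)
  have A0: "A $$ (i, j) = 0" if "i < j" "j < \<nu>" for i j
    using tab that by (auto simp: imex_tableau_def)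
  define local_eq where "local_eq g \<longleftrightarrow> (\<forall>x\<in>\<Omega>. \<forall>v. g x v = maxwellian (g x) v)" for g :: "'d phase"
  have local_eq_cong: "local_eq g" if "local_eq h" "\<And>x v. x \<in> \<Omega> \<Longrightarrow> g x v = h x v" for g h
  proof -
    have "g x = h x" if "x \<in> \<Omega>" for x using \<open>\<And>x v. x \<in> \<Omega> \<Longrightarrow> g x v = h x v\<close> that by (simp add: fun_eq_iff)
    then show ?thesis using \<open>local_eq h\<close> by (simp add: local_eq_def)
  qed
  have QP0: "(\<forall>x\<in>\<Omega>. \<forall>v. QP g x v = 0) \<longleftrightarrow> local_eq g" if "g \<in> \<D>" for g
    using QP that by (auto simp: collision_like_def local_eq_def)
  have GP0: "G_P B QP g x v = 0" if "g \<in> \<D>" "local_eq g" "x \<in> \<Omega>" for g x v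
    using QB QP0[OF that(1)] that by (auto simp: collision_like_def local_eq_def G_P_def)

  have stage: "F \<epsilon> n i x v = f \<epsilon> n x v
        + \<Delta>t * (\<Sum>j<\<nu>. At $$ (i, j) * (1 / \<epsilon> * G_P B QP (F \<epsilon> n j) x v + transport \<iota> (F \<epsilon> n j) x v))
        + \<Delta>t / \<epsilon> * (\<Sum>j<\<nu>. A $$ (i, j) * QP (F \<epsilon> n j) x v)"
    if "\<epsilon> > 0" "i < \<nu>" "x \<in> \<Omega>" for \<epsilon> n i x v
    using step[OF that(1), of n] that by (simp add: penalized_imex_step_def)
  have update: "f \<epsilon> (Suc n) x v = f \<epsilon> n x v
        + \<Delta>t * (\<Sum>j<\<nu>. vec_index wt j * (1 / \<epsilon> * G_P B QP (F \<epsilon> n j) x v + transport \<iota> (F \<epsilon> n j) x v))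
        + \<Delta>t / \<epsilon> * (\<Sum>j<\<nu>. vec_index w j * QP (F \<epsilon> n j) x v)"
    if "\<epsilon> > 0" "x \<in> \<Omega>" for \<epsilon> n x v
    using step[OF that(1), of n] that by (simp add: penalized_imex_step_def)

  \<comment> \<open>The first row of both matrices is zero, so the first stage is the value at the old time.\<close>
  have first: "Flim n 0 x v = flim n x v" if x: "x \<in> \<Omega>" for n x v
  proof -
    have "F \<epsilon> n 0 x v = f \<epsilon> n x v" if "\<epsilon> > 0" for \<epsilon>
      using stage[OF that \<nu> x] by (simp add: At0 type_CK_first_row[OF tab CK])
    moreover have "((\<lambda>\<epsilon>. F \<epsilon> n 0 x v) \<longlongrightarrow> Flim n 0 x v) (at_right 0)"
      using Flim[OF \<nu>] x by (simp add: formal_limit_def)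
    moreover have "((\<lambda>\<epsilon>. f \<epsilon> n x v) \<longlongrightarrow> flim n x v) (at_right 0)"
      using flim x by (simp add: formal_limit_def)
    ultimately show ?thesis by (rule limits_agree_at_right)
  qed
  \<comment> \<open>Global stiff accuracy: the update has the coefficients of the last stage.\<close>
  have last: "flim (Suc n) x v = Flim n (\<nu> - 1) x v" if x: "x \<in> \<Omega>" for n x v
  proof -
    have "F \<epsilon> n (\<nu> - 1) x v = f \<epsilon> (Suc n) x v" if "\<epsilon> > 0" for \<epsilon>
      using stage[OF that _ x, of "\<nu> - 1"] update[OF that x] \<nu> GSA by (simp add: globally_stiffly_accurate_def)
    moreover have "((\<lambda>\<epsilon>. F \<epsilon> n (\<nu> - 1) x v) \<longlongrightarrow> Flim n (\<nu> - 1) x v) (at_right 0)"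
      using Flim[of "\<nu> - 1" n] \<nu> x by (simp add: formal_limit_def)
    moreover have "((\<lambda>\<epsilon>. f \<epsilon> (Suc n) x v) \<longlongrightarrow> flim (Suc n) x v) (at_right 0)"
      using flim x by (simp add: formal_limit_def)
    ultimately have "Flim n (\<nu> - 1) x v = flim (Suc n) x v" by (rule limits_agree_at_right)
    then show ?thesis ..
  qed
  \<comment> \<open>The equation of a stage to order \<open>1 / \<epsilon>\<close>.\<close>
  have balance: "(\<Sum>j<\<nu>. At $$ (i, j) * G_P B QP (Flim n j) x v) + (\<Sum>j<\<nu>. A $$ (i, j) * QP (Flim n j) x v) = 0"
    if "i < \<nu>" "x \<in> \<Omega>" for n i x v
  proof (rule stiff_limit_balance)
    show "F \<epsilon> n i x v = f \<epsilon> n x v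
        + \<Delta>t * (\<Sum>j<\<nu>. At $$ (i, j) * (1 / \<epsilon> * G_P B QP (F \<epsilon> n j) x v + transport \<iota> (F \<epsilon> n j) x v))
        + \<Delta>t / \<epsilon> * (\<Sum>j<\<nu>. A $$ (i, j) * QP (F \<epsilon> n j) x v)" if "\<epsilon> > 0" for \<epsilon>
      using stage that \<open>i < \<nu>\<close> \<open>x \<in> \<Omega>\<close> by blast
    show "((\<lambda>\<epsilon>. F \<epsilon> n i x v) \<longlongrightarrow> Flim n i x v) (at_right 0)"
      using Flim[OF that(1)] that(2) by (simp add: formal_limit_def)
    show "((\<lambda>\<epsilon>. f \<epsilon> n x v) \<longlongrightarrow> flim n x v) (at_right 0)"
      using flim that(2) by (simp add: formal_limit_def)
    show "\<Delta>t \<noteq> 0" using dt by simp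
  qed (use Flim that(2) in \<open>auto simp: formal_limit_def\<close>)

  \<comment> \<open>Only the diagonal term of the balance survives when all earlier stages are Maxwellian.\<close>
  have stages_eq: "local_eq (Flim n i)" if flim_eq: "local_eq (flim n)" and "i < \<nu>" for n i
    using \<open>i < \<nu>\<close>
  proof (induction i rule: less_induct)
    case (less i)
    show ?case
    proof (cases "i = 0")
      case True
      then show ?thesis using local_eq_cong[OF flim_eq] first by simp
    next
      case False
      have "QP (Flim n i) x v = 0" if x: "x \<in> \<Omega>" for x v
      proof -
        have prev: "local_eq (Flim n j)" if "j < i" for j using less that by simp
        have QP_prev: "QP (Flim n j) x v = 0" if "j < i" for j
          using QP0[OF FlimD, of j n] prev[OF that] that less.prems x by simp
        have "(\<Sum>j<\<nu>. At $$ (i, j) * G_P B QP (Flim n j) x v) = 0"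
        proof (intro sum.neutral ballI)
          fix j assume "j \<in> {..<\<nu>}"
          then show "At $$ (i, j) * G_P B QP (Flim n j) x v = 0"
            using prev GP0[OF FlimD _ x] At0[of i j] by (cases "j < i") auto
        qed
        moreover have "(\<Sum>j<\<nu>. A $$ (i, j) * QP (Flim n j) x v) = (\<Sum>j\<in>{i}. A $$ (i, j) * QP (Flim n j) x v)"
        proof (intro sum.mono_neutral_right ballI)
          fix j assume "j \<in> {..<\<nu>} - {i}"
          then show "A $$ (i, j) * QP (Flim n j) x v = 0"
            using QP_prev A0[of i j] by (cases j i rule: linorder_cases) auto
        qed (use less.prems in auto)
        ultimately have "A $$ (i, i) * QP (Flim n i) x v = 0"
          using balance[OF less.prems x, of n v] by simp
        then show ?thesis using type_CK_diagonal_nonzero[OF tab CK _ less.prems] False by simp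
      qed
      then show ?thesis using QP0[OF FlimD[OF less.prems]] by blast
    qed
  qed
  have flim_eq: "local_eq (flim n)" for n
  proof (induction n)
    case 0
    obtain g where g: "\<And>\<epsilon> x v. \<epsilon> > 0 \<Longrightarrow> x \<in> \<Omega> \<Longrightarrow> f\<^sub>0 \<epsilon> x v = maxwellian (f\<^sub>0 \<epsilon> x) v + g \<epsilon> x v"
      and g0: "\<And>x v. x \<in> \<Omega> \<Longrightarrow> ((\<lambda>\<epsilon>. g \<epsilon> x v) \<longlongrightarrow> 0) (at_right 0)"
      using init by (auto simp: consistent_initial_data_def)
    show ?case unfolding local_eq_def
    proof (intro ballI allI)
      fix x v assume x: "x \<in> \<Omega>"
      have lim_eq: "((\<lambda>\<epsilon>. maxwellian (f \<epsilon> 0 x) v + g \<epsilon> x v) \<longlongrightarrow> maxwellian (flim 0 x) v + 0) (at_right 0)"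
        using flim[of 0] x by (intro tendsto_add g0) (auto simp: formal_limit_def)
      have lim: "((\<lambda>\<epsilon>. f \<epsilon> 0 x v) \<longlongrightarrow> flim 0 x v) (at_right 0)"
        using flim x by (simp add: formal_limit_def)
      have eq: "f \<epsilon> 0 x v = maxwellian (f \<epsilon> 0 x) v + g \<epsilon> x v" if "\<epsilon> > 0" for \<epsilon>
        unfolding f0[OF that] by (rule g[OF that x])
      have "flim 0 x v = maxwellian (flim 0 x) v + 0"
        using eq lim lim_eq by (rule limits_agree_at_right)
      then show "flim 0 x v = maxwellian (flim 0 x) v" by simp
    qed
  next
    case (Suc n)
    have "local_eq (Flim n (\<nu> - 1))" using stages_eq[OF Suc] \<nu> by simp
    then show ?case using local_eq_cong last by blast
  qed
  have Flim_eq: "Flim n i x v = maxwellian (Flim n i x) v" if "i < \<nu>" "x \<in> \<Omega>" for i x v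
    using stages_eq[OF flim_eq that(1)] that(2) by (simp add: local_eq_def)

  note euler = moments_transport_maxwellian[OF \<Omega> adm FlimD Flim_eq]
  \<comment> \<open>A stage and the update have moment equations of the same form, with different coefficients.\<close>
  have moments_limit: "M\<^sub>0 = moments (flim n x) - \<Delta>t *\<^sub>R (\<Sum>j<\<nu>. a j *\<^sub>R div_euler_flux \<iota> (\<lambda>y. moments (Flim n j y)) x)"
    if x: "x \<in> \<Omega>" and lim: "((\<lambda>\<epsilon>. moments (h \<epsilon>)) \<longlongrightarrow> M\<^sub>0) (at_right 0)"
      and h: "\<And>\<epsilon> v. \<epsilon> > 0 \<Longrightarrow> h \<epsilon> v = f \<epsilon> n x v
        + \<Delta>t * (\<Sum>j<\<nu>. a j * (1 / \<epsilon> * G_P B QP (F \<epsilon> n j) x v + transport \<iota> (F \<epsilon> n j) x v))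
        + \<Delta>t / \<epsilon> * (\<Sum>j<\<nu>. b j * QP (F \<epsilon> n j) x v)"
    for x M\<^sub>0 a b and h :: "real \<Rightarrow> real^3 \<Rightarrow> real"
  proof -
    have eq: "moments (h \<epsilon>) = moments (f \<epsilon> n x) + \<Delta>t *\<^sub>R (\<Sum>j<\<nu>. a j *\<^sub>R moments (transport \<iota> (F \<epsilon> n j) x))"
      if \<epsilon>: "\<epsilon> > 0" for \<epsilon>
    proof (rule moments_penalized_combination[OF h[OF \<epsilon>]])
      show "integrable lborel (\<lambda>v. f \<epsilon> n x v *\<^sub>R phi v)"
        using adm fD[OF \<epsilon>] x by (auto simp: admissible_class_def)
      fix j assume "j < \<nu>"
      then have D: "F \<epsilon> n j \<in> \<D>" by (rule FD[OF \<epsilon>])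
      show "integrable lborel (\<lambda>v. transport \<iota> (F \<epsilon> n j) x v *\<^sub>R phi v)"
        using adm D x by (auto simp: admissible_class_def)
      show Q: "has_bochner_integral lborel (\<lambda>v. QP (F \<epsilon> n j) x v *\<^sub>R phi v) 0"
        using QP D x by (auto simp: collision_like_def)
      have "has_bochner_integral lborel (\<lambda>v. Q_B B (F \<epsilon> n j) x v *\<^sub>R phi v) 0"
        using QB D x by (auto simp: collision_like_def)
      from has_bochner_integral_diff[OF this Q]
      show "has_bochner_integral lborel (\<lambda>v. G_P B QP (F \<epsilon> n j) x v *\<^sub>R phi v) 0"
        by (simp add: G_P_def scaleR_diff_left)
    qed
    have lim': "((\<lambda>\<epsilon>. moments (f \<epsilon> n x) + \<Delta>t *\<^sub>R (\<Sum>j<\<nu>. a j *\<^sub>R moments (transport \<iota> (F \<epsilon> n j) x)))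
        \<longlongrightarrow> moments (flim n x) + \<Delta>t *\<^sub>R (\<Sum>j<\<nu>. a j *\<^sub>R moments (transport \<iota> (Flim n j) x))) (at_right 0)"
      using flim[of n] Flim[of _ n] x by (intro tendsto_intros) (auto simp: formal_limit_def)
    have "M\<^sub>0 = moments (flim n x) + \<Delta>t *\<^sub>R (\<Sum>j<\<nu>. a j *\<^sub>R moments (transport \<iota> (Flim n j) x))"
      using eq lim lim' by (rule limits_agree_at_right)
    also have "(\<Sum>j<\<nu>. a j *\<^sub>R moments (transport \<iota> (Flim n j) x))
        = - (\<Sum>j<\<nu>. a j *\<^sub>R div_euler_flux \<iota> (\<lambda>y. moments (Flim n j y)) x)"
      using x by (simp add: euler sum_negf)
    finally show ?thesis by simp
  qed
  have "explicit_RK_euler_step \<Omega> \<iota> \<nu> At wt \<Delta>t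
      (\<lambda>x. moments (flim n x)) (\<lambda>i x. moments (Flim n i x)) (\<lambda>x. moments (flim (Suc n) x))"
    unfolding explicit_RK_euler_step_def
  proof (intro ballI conjI allI impI)
    fix x assume x: "x \<in> \<Omega>"
    show "partially_differentiable k (\<lambda>y. euler_flux (\<iota> k) (moments (Flim n i y))) x" if "i < \<nu>" for i k
      using partially_differentiable_flux[OF \<Omega> adm FlimD[OF that] Flim_eq[OF that] x] by blast
    show "moments (flim (Suc n) x) = moments (flim n x)
        - \<Delta>t *\<^sub>R (\<Sum>i<\<nu>. vec_index wt i *\<^sub>R div_euler_flux \<iota> (\<lambda>y. moments (Flim n i y)) x)"
      using flim[of "Suc n"] x by (intro moments_limit[OF x _ update[OF _ x]]) (auto simp: formal_limit_def)
    fix i assume i: "i < \<nu>"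
    have "moments (Flim n i x) = moments (flim n x)
        - \<Delta>t *\<^sub>R (\<Sum>j<\<nu>. At $$ (i, j) *\<^sub>R div_euler_flux \<iota> (\<lambda>y. moments (Flim n j y)) x)"
      using Flim[OF i, of n] x by (intro moments_limit[OF x _ stage[OF _ i x]]) (auto simp: formal_limit_def)
    also have "(\<Sum>j<\<nu>. At $$ (i, j) *\<^sub>R div_euler_flux \<iota> (\<lambda>y. moments (Flim n j y)) x)
        = (\<Sum>j<i. At $$ (i, j) *\<^sub>R div_euler_flux \<iota> (\<lambda>y. moments (Flim n j y)) x)"
      using i At0 by (intro sum.mono_neutral_right) auto
    finally show "moments (Flim n i x) = moments (flim n x)
        - \<Delta>t *\<^sub>R (\<Sum>j<i. At $$ (i, j) *\<^sub>R div_euler_flux \<iota> (\<lambda>y. moments (Flim n j y)) x)" .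
  qed
  then show "(\<forall>i<\<nu>. \<forall>x\<in>\<Omega>. \<forall>v. Flim n i x v = maxwellian (Flim n i x) v) \<and>
    explicit_RK_euler_step \<Omega> \<iota> \<nu> At wt \<Delta>t
      (\<lambda>x. moments (flim n x)) (\<lambda>i x. moments (Flim n i x)) (\<lambda>x. moments (flim (Suc n) x))"
    using Flim_eq by blast
qed

end
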